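(* Let $\Delta(x)$ be the error term associated with the real sequence $\{a_n\}_{n\ge 1}$, and $A(s)$ its Mellin transform (together with its continuation), as defined in the context. Suppose there is a real number $\sigma_0$ such that the following hold. (i) There exists a real $t_0\neq 0$ such that $\lambda:=\limsup_{\sigma\searrow\sigma_0}(\sigma-\sigma_0)|A(\sigma+it_0)|>0$ (with $\lambda$ finite). (ii) $l_s:=\limsup_{\sigma\searrow\sigma_0}(\sigma-\sigma_0)A(\sigma)<\infty$ and $l_i:=\liminf_{\sigma\searrow\sigma_0}(\sigma-\sigma_0)A(\sigma)>-\infty$. (iii) $l_i+\lambda>0$ and $l_s-\lambda<0$. (iv) $A(s)$ can be analytically continued to a region containing the real half-line $\{\sigma\in\mathbb{R}:\sigma>\sigma_0\}$. Fix $\epsilon$ with $0<\epsilon<\min(\lambda+l_i,\lambda-l_s)$ and put $$\mathcal{A}_1=\{x\in[1,\infty):\Delta(x)>(l_i+\lambda-\epsilon)x^{\sigma_0}\},\qquad \mathcal{A}_2=\{x\in[1,\infty):\Delta(x)<(l_s-\lambda+\epsilon)x^{\sigma_0}\}.$$ Let $h_1,h_2$ be two positive functions such that $$\int_{[T,2T]\cap\mathcal{A}_j}\frac{\Delta^2(x)}{x^{2\sigma_0+1}}\,dx\ll h_j(T)\qquad\text{for } j=1,2.$$ Then, as $T\to\infty$, $$\mathfrak{m}(\mathcal{A}_j\cap[T,2T])=\Omega\left(\frac{T}{h_j(T)}\right)\qquad\text{for } j=1,2.$$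
   Context: Setting. $\{a_n\}_{n\ge1}$ is a sequence of real numbers with Dirichlet series $D(s)=\sum_{n\ge1}a_n n^{-s}$. There are real numbers $T_0>0$ and $0<\sigma_1<\sigma_2$ such that: $D(s)$ converges absolutely for $\Re(s)>\sigma_2$; $D(s)$ continues meromorphically to $\Re(s)>\sigma_1$ and is analytic on the segments $\{\sigma+it:\sigma_1\le\sigma\le\sigma_2,\ t=\pm T_0\}$ and $\{\sigma_1+it:-T_0\le t\le T_0\}$. Let $\mathcal{P}$ be the (finite) set of poles $\sigma+it$ of $D$ with $\sigma>\sigma_1$, $|t|<T_0$. The main term is $\mathcal{M}(x)=\sum_{\rho\in\mathcal{P}}\mathrm{Res}_{s=\rho}\big(D(s)x^s/s\big)$, and the error term is $\Delta(x)=\sum^*_{n\le x}a_n-\mathcal{M}(x)$, where $\sum^*_{n\le x}a_n=\sum_{n\le x}a_n$ if $x\notin\mathbb{N}$ and $\sum^*_{n\le x}a_n=\sum_{n<x}a_n+\frac12a_x$ if $x\in\mathbb{N}$. Mellin transform. $A(s)=\int_1^\infty \Delta(x)x^{-s-1}\,dx$, which converges absolutely in some right half-plane. The symbol $A(s)$ also denotes the meromorphic continuation of this function to a connected open set containing that half-plane, the half-line $\{\sigma>\sigma_0\}$, and the points $\sigma+it_0$ for $\sigma>\sigma_0$ close to $\sigma_0$. Notation. $\mathfrak{m}$ is Lebesgue measure on $\mathbb{R}$. For a nonnegative function $F$ and a positive function $f$, $F(T)=\Omega(f(T))$ as $T\to\infty$ means that $F(T)=o(f(T))$ is false, i.e.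 $\limsup_{T\to\infty}F(T)/f(T)>0$. $F\ll f$ means $F(T)\le Cf(T)$ for some constant $C$.
   Formalization: The connected open set on which A(s) is continued is also assumed to meet the half-plane Re(s)>σ_0 in a connected set; otherwise the values A(σ+it_0) may lie on another branch, reached by leaving this half-plane, and the claim can fail. *)

theory Defs
  imports
    "HOL-Complex_Analysis.Complex_Analysis"
    "HOL-Library.Landau_Symbols"
begin

text \<open>
  The argument \<open>D\<close> stands for the Dirichlet series together with its meromorphic continuation.
  Being nicely meromorphic only fixes the values of a meromorphic function at its
  singularities: removable ones are removed, and the value at a pole is 0.
\<close>

definition dirichlet_setting ::
  "(nat \<Rightarrow> real) \<Rightarrow> (complex \<Rightarrow> complex) \<Rightarrow> real \<Rightarrow> real \<Rightarrow> real \<Rightarrow> bool" where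
  "dirichlet_setting a D T\<^sub>0 \<sigma>\<^sub>1 \<sigma>\<^sub>2 \<longleftrightarrow>
     0 < T\<^sub>0 \<and> 0 < \<sigma>\<^sub>1 \<and> \<sigma>\<^sub>1 < \<sigma>\<^sub>2 \<and>
     (\<forall>s. Re s > \<sigma>\<^sub>2 \<longrightarrow>
        (\<lambda>n. norm (of_real (a n) * of_nat n powr (-s))) summable_on {1..} \<and>
        D s = (\<Sum>\<^sub>\<infinity>n\<in>{1..}. of_real (a n) * of_nat n powr (-s))) \<and>
     D nicely_meromorphic_on {s. Re s > \<sigma>\<^sub>1} \<and>
     D analytic_on {s. \<sigma>\<^sub>1 \<le> Re s \<and> Re s \<le> \<sigma>\<^sub>2 \<and> (Im s = T\<^sub>0 \<or> Im s = - T\<^sub>0)} \<and>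
     D analytic_on {s. Re s = \<sigma>\<^sub>1 \<and> - T\<^sub>0 \<le> Im s \<and> Im s \<le> T\<^sub>0}"

definition pole_set :: "(complex \<Rightarrow> complex) \<Rightarrow> real \<Rightarrow> real \<Rightarrow> complex set" where
  "pole_set D T\<^sub>0 \<sigma>\<^sub>1 = {\<rho>. Re \<rho> > \<sigma>\<^sub>1 \<and> \<bar>Im \<rho>\<bar> < T\<^sub>0 \<and> is_pole D \<rho>}"

definition main_term :: "(complex \<Rightarrow> complex) \<Rightarrow> real \<Rightarrow> real \<Rightarrow> real \<Rightarrow> complex" where
  "main_term D T\<^sub>0 \<sigma>\<^sub>1 x =
     (\<Sum>\<rho>\<in>pole_set D T\<^sub>0 \<sigma>\<^sub>1. residue (\<lambda>s. D s * of_real x powr s / s) \<rho>)"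

definition starred_sum :: "(nat \<Rightarrow> real) \<Rightarrow> real \<Rightarrow> real" where
  "starred_sum a x =
     (if x \<in> \<nat> then (\<Sum>n | 1 \<le> n \<and> real n < x. a n) + a (nat \<lfloor>x\<rfloor>) / 2
      else (\<Sum>n | 1 \<le> n \<and> real n \<le> x. a n))"

text \<open>
  Since \<open>a\<close> is real, \<open>D (cnj s) = cnj (D s)\<close> for \<open>Re s > \<sigma>\<^sub>1\<close>, the pole set is closed under
  conjugation and the main term is real; taking the real part only adjusts the type.
\<close>

definition error_term ::
  "(nat \<Rightarrow> real) \<Rightarrow> (complex \<Rightarrow> complex) \<Rightarrow> real \<Rightarrow> real \<Rightarrow> real \<Rightarrow> real" where
  "error_term a D T\<^sub>0 \<sigma>\<^sub>1 x = starred_sum a x - Re (main_term D T\<^sub>0 \<sigma>\<^sub>1 x)"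

text \<open>
  \<open>A\<close> is the meromorphic continuation to the connected open set \<open>U\<close> of the Mellin transform
  of \<open>\<Delta>\<close>, which converges absolutely in some right half-plane contained in \<open>U\<close>.
  Connectedness of \<open>U\<close> alone does not make \<open>A\<close> agree on \<open>U \<inter> {s. Re s > \<sigma>}\<close> with a
  holomorphic extension of the transform to \<open>Re s > \<sigma>\<close>: a path that leaves this half-plane
  may return to it on another sheet. This needs \<open>U \<inter> {s. Re s > \<sigma>}\<close> to be connected as well.
\<close>

definition mellin_continuation ::
  "(real \<Rightarrow> real) \<Rightarrow> (complex \<Rightarrow> complex) \<Rightarrow> complex set \<Rightarrow> bool" where
  "mellin_continuation \<Delta> A U \<longleftrightarrow>
     open U \<and> connected U \<and> A nicely_meromorphic_on U \<and>
     (\<exists>c::real. \<forall>s. Re s > c \<longrightarrow>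
        s \<in> U \<and>
        set_integrable lborel {1..} (\<lambda>x. of_real (\<Delta> x) * of_real x powr (-s-1)) \<and>
        A s = (LINT x:{1..}|lborel. of_real (\<Delta> x) * of_real x powr (-s-1)))"

end

theory Submission
  imports Defs
begin

text \<open>
  Suppose \<open>m(A\<^sub>1 \<inter> [T, 2T]) = o(T / h\<^sub>1(T))\<close>. By the Cauchy--Schwarz inequality the integral of
  \<open>\<bar>\<Delta>(x)\<bar> x powr (-\<sigma>\<^sub>0 - 1)\<close> over \<open>A\<^sub>1 \<inter> [T, 2T]\<close> tends to 0, so the Mellin transform \<open>G\<close> of the
  restriction of \<open>\<bar>\<Delta>\<bar>\<close> to \<open>A\<^sub>1\<close> converges for \<open>\<sigma> > \<sigma>\<^sub>0\<close> and is \<open>o(1 / (\<sigma> - \<sigma>\<^sub>0))\<close>. With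
  \<open>c\<^sub>0 = l\<^sub>i + \<lambda> - \<epsilon>\<close>, the function \<open>c\<^sub>0 x powr \<sigma>\<^sub>0 + \<bar>\<Delta>(x)\<bar> [x \<in> A\<^sub>1] - \<Delta>(x)\<close> is nonnegative, and its
  transform \<open>B(s) = c\<^sub>0 / (s - \<sigma>\<^sub>0) + G(s) - A(s)\<close> has no real singularity to the right of \<open>\<sigma>\<^sub>0\<close>. By
  Landau's theorem it converges for \<open>\<sigma> > \<sigma>\<^sub>0\<close>, so \<open>\<bar>B(\<sigma> + it\<^sub>0)\<bar> \<le> B(\<sigma>)\<close>. Multiplying by \<open>\<sigma> - \<sigma>\<^sub>0\<close> and
  letting \<open>\<sigma> \<rightarrow> \<sigma>\<^sub>0\<close> gives \<open>\<lambda> \<le> c\<^sub>0 - l\<^sub>i = \<lambda> - \<epsilon>\<close>, which is absurd. The claim for \<open>A\<^sub>2\<close> is the same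
  statement for \<open>-\<Delta>\<close> and \<open>-A\<close>.
\<close>

section \<open>Landau's theorem on the abscissa of convergence\<close>

text \<open>The exponential series in \<open>d * l\<close>, times the weight at
  \<open>\<beta>\<close>, moves the exponent to \<open>\<beta> - d\<close>. When \<open>y\<close>,
  \<open>d\<close> and \<open>l\<close> are nonnegative, the closed form bounds every partial sum
  and every single term.\<close>

lemma exp_weight_sums:
  fixes y \<beta> d l :: real
  shows "(\<lambda>n. y * exp (- (\<beta> * l)) * ((d * l) ^ n / fact n)) sums (y * exp (- ((\<beta> - d) * l)))"
proof -
  have "(\<lambda>n. (d * l) ^ n / fact n) sums exp (d * l)"
    using exp_converges[of "d * l"] by (simp add: divide_inverse mult.commute)
  from sums_mult[OF this, of "y * exp (- (\<beta> * l))"] show ?thesis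
    by (simp add: algebra_simps flip: exp_add)
qed

text \<open>The Mellin transform is the case \<open>L = ln\<close> on
  \<open>[1, \<infinity>)\<close>. Nonnegativity of the kernel makes
  \<open>exp (- (\<sigma> * L x))\<close> nonincreasing in \<open>\<sigma>\<close>, so convergence
  passes to larger abscissae.\<close>

locale laplace_kernel =
  fixes M :: "'a measure" and L :: "'a \<Rightarrow> real"
  assumes measurable_kernel [measurable]: "L \<in> borel_measurable M"
    and kernel_nonneg: "x \<in> space M \<Longrightarrow> 0 \<le> L x"
begin

text \<open>Integrability is absolute convergence, and the modulus of
  \<open>exp (- (s * L x))\<close> depends on \<open>Re s\<close> only, so a real argument
  suffices.\<close>

definition converges :: "('a \<Rightarrow> real) \<Rightarrow> real \<Rightarrow> bool" where
  "converges f \<sigma> \<longleftrightarrow> integrable M (\<lambda>x. f x * exp (- (\<sigma> * L x)))"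

definition transform :: "('a \<Rightarrow> real) \<Rightarrow> complex \<Rightarrow> complex" where
  "transform f s = (LINT x|M. of_real (f x) * exp (- (s * of_real (L x))))"

lemma converges_mono:
  assumes [measurable]: "f \<in> borel_measurable M" and "converges f \<sigma>" "\<sigma> \<le> \<tau>"
  shows "converges f \<tau>"
  unfolding converges_def
proof (rule Bochner_Integration.integrable_bound)
  show "integrable M (\<lambda>x. f x * exp (- (\<sigma> * L x)))"
    using assms(2) by (simp add: converges_def)
  show "AE x in M. norm (f x * exp (- (\<tau> * L x))) \<le> norm (f x * exp (- (\<sigma> * L x)))"
    using kernel_nonneg assms(3)
    by (intro AE_I2) (auto simp: abs_mult intro!: mult_left_mono mult_right_mono)
qed measurable

lemma integrable_transform:
  assumes [measurable]: "f \<in> borel_measurable M" and "converges f (Re s)"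
  shows "integrable M (\<lambda>x. complex_of_real (f x) * exp (- (s * of_real (L x))))"
proof (rule Bochner_Integration.integrable_bound)
  show "integrable M (\<lambda>x. f x * exp (- (Re s * L x)))"
    using assms(2) by (simp add: converges_def)
qed (auto simp: norm_mult)

lemma transform_of_real:
  "transform f (of_real \<sigma>) = of_real (LINT x|M. f x * exp (- (\<sigma> * L x)))"
  unfolding transform_def by (simp flip: exp_of_real integral_complex_of_real)

lemma norm_transform_le:
  assumes "\<And>x. x \<in> space M \<Longrightarrow> 0 \<le> f x"
  shows "norm (transform f s) \<le> (LINT x|M. f x * exp (- (Re s * L x)))"
proof -
  have "norm (transform f s) \<le> (LINT x|M. norm (of_real (f x) * exp (- (s * of_real (L x)))))"
    unfolding transform_def by (rule integral_norm_bound)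
  also have "\<dots> = (LINT x|M. f x * exp (- (Re s * L x)))"
    using assms by (intro Bochner_Integration.integral_cong) (auto simp: norm_mult)
  finally show ?thesis .
qed

text \<open>The factor \<open>exp (- (w * L x))\<close> is expanded and integrated term by term. The
  norms of the terms sum to \<open>\<bar>f x\<bar> * exp (- ((Re b - norm w) * L x))\<close>, which
  is integrable because \<open>Re b - norm w\<close> exceeds \<open>c\<close>.\<close>

lemma transform_power_series:
  assumes [measurable]: "f \<in> borel_measurable M" and conv: "converges f c"
    and w: "c + norm w < Re b"
  shows "(\<lambda>n. (LINT x|M. of_real (f x) * exp (- (b * of_real (L x))) *
             ((- of_real (L x)) ^ n / fact n)) * w ^ n) sums transform f (b + w)"
proof -
  define g where "g = (\<lambda>n x. complex_of_real (f x) * exp (- (b * of_real (L x))) *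
             ((- of_real (L x)) ^ n / fact n) * w ^ n)"
  have [measurable]: "g n \<in> borel_measurable M" for n
    unfolding g_def by measurable
  have norm_g: "norm (g n x) = \<bar>f x\<bar> * exp (- (Re b * L x)) * ((norm w * L x) ^ n / fact n)"
    if "x \<in> space M" for n x
    using kernel_nonneg[OF that]
    by (simp add: g_def norm_mult norm_divide norm_power power_mult_distrib abs_mult)
  have norm_sum: "(\<Sum>n<N. norm (g n x)) \<le> \<bar>f x\<bar> * exp (- ((Re b - norm w) * L x))"
    if "x \<in> space M" for N x
    using sum_le_suminf[OF sums_summable[OF exp_weight_sums[of "\<bar>f x\<bar>" "Re b" "L x" "norm w"]], of "{..<N}"] kernel_nonneg[OF that]
    unfolding sums_unique[OF exp_weight_sums, symmetric] by (simp add: norm_g[OF that])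
  have int0: "integrable M (\<lambda>x. \<bar>f x\<bar> * exp (- ((Re b - norm w) * L x)))"
    using integrable_norm[OF converges_mono[OF assms(1) conv, of "Re b - norm w", unfolded converges_def]] w
    by (simp add: abs_mult)
  have int_g: "integrable M (g n)" for n
  proof (rule Bochner_Integration.integrable_bound[OF int0])
    show "AE x in M. norm (g n x) \<le> norm (\<bar>f x\<bar> * exp (- ((Re b - norm w) * L x)))"
    proof (rule AE_I2)
      fix x assume x: "x \<in> space M"
      have "norm (g n x) \<le> (\<Sum>k<Suc n. norm (g k x))"
        by (intro member_le_sum) auto
      also have "\<dots> \<le> \<bar>f x\<bar> * exp (- ((Re b - norm w) * L x))"
        by (rule norm_sum[OF x])
      finally show "norm (g n x) \<le> norm (\<bar>f x\<bar> * exp (- ((Re b - norm w) * L x)))"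
        by simp
    qed
  qed measurable
  have "(\<lambda>n. LINT x|M. g n x) sums (LINT x|M. (\<Sum>n. g n x))"
  proof (rule sums_integral)
    show "AE x in M. summable (\<lambda>n. norm (g n x))"
      using exp_weight_sums by (intro AE_I2) (simp add: norm_g sums_iff)
    show "summable (\<lambda>n. LINT x|M. norm (g n x))"
    proof (rule bounded_imp_summable)
      fix N
      have "(\<Sum>n\<le>N. LINT x|M. norm (g n x)) = (LINT x|M. (\<Sum>n\<le>N. norm (g n x)))"
        using int_g by (subst Bochner_Integration.integral_sum) auto
      also have "\<dots> \<le> (LINT x|M. \<bar>f x\<bar> * exp (- ((Re b - norm w) * L x)))"
        using int_g norm_sum[of _ "Suc N"]
        by (intro integral_mono int0 Bochner_Integration.integrable_sum integrable_norm)
           (auto simp: lessThan_Suc_atMost)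
      finally show "(\<Sum>n\<le>N. LINT x|M. norm (g n x)) \<le> \<dots>" .
    qed auto
  qed (use int_g in auto)
  moreover have "(\<Sum>n. g n x) = of_real (f x) * exp (- ((b + w) * of_real (L x)))" for x
  proof -
    have "(\<lambda>n. (- (w * of_real (L x))) ^ n / fact n) sums exp (- (w * of_real (L x)))"
      using exp_converges[of "- (w * complex_of_real (L x))"]
      by (simp add: divide_inverse mult.commute scaleR_conv_of_real)
    from sums_mult[OF this, of "of_real (f x) * exp (- (b * of_real (L x)))"]
    have "(\<lambda>n. of_real (f x) * exp (- (b * of_real (L x))) * ((- (w * of_real (L x))) ^ n / fact n))
        sums (of_real (f x) * exp (- ((b + w) * of_real (L x))))"
      by (simp add: algebra_simps flip: exp_add)
    moreover have "(- (w * complex_of_real (L x))) ^ n = (- of_real (L x)) ^ n * w ^ n" for n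
      by (simp flip: power_mult_distrib add: mult.commute)
    ultimately show ?thesis
      by (simp add: g_def sums_iff mult.assoc)
  qed
  moreover have "(LINT x|M. g n x) = (LINT x|M. of_real (f x) * exp (- (b * of_real (L x))) *
             ((- of_real (L x)) ^ n / fact n)) * w ^ n" for n
    unfolding g_def by simp
  ultimately show ?thesis
    by (simp add: transform_def)
qed

lemma transform_holomorphic:
  assumes [measurable]: "f \<in> borel_measurable M" and conv: "\<And>\<sigma>. c < \<sigma> \<Longrightarrow> converges f \<sigma>"
  shows "transform f holomorphic_on {s. c < Re s}"
proof (rule analytic_imp_holomorphic, subst analytic_on_analytic_at, rule ballI)
  fix b assume b: "b \<in> {s. c < Re s}"
  \<comment> \<open>Since \<open>Re b = c + 2 * r\<close>, convergence at \<open>c + r\<close>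
    together with \<open>norm (z - b) < r\<close> allows the power series expansion at
    \<open>b\<close>.\<close>
  define r where "r = (Re b - c) / 2"
  have "(\<lambda>n. (LINT x|M. of_real (f x) * exp (- (b * of_real (L x))) *
             ((- of_real (L x)) ^ n / fact n)) * (z - b) ^ n) sums transform f z"
    if "z \<in> ball b r" for z
    using transform_power_series[of f "c + r" "z - b" b] conv[of "c + r"] that b
    by (auto simp: r_def dist_norm norm_minus_commute field_simps)
  then have "transform f holomorphic_on ball b r"
    by (rule power_series_holomorphic)
  then show "transform f analytic_on {b}"
    using b by (auto simp: r_def intro!: holomorphic_on_imp_analytic_at[of _ "ball b r"])
qed

text \<open>
  Around a point just to the right of the abscissa of convergence, the Taylor coefficients of the
  transform of a nonnegative function have alternating signs, so convergence of the Taylor series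
  at a real point to the left of the abscissa forces convergence of the integral there.
\<close>

lemma landau_abscissa:
  assumes [measurable]: "f \<in> borel_measurable M" and nonneg: "\<And>x. x \<in> space M \<Longrightarrow> 0 \<le> f x"
    and conv: "converges f c"
    and W: "open W" "E holomorphic_on W" "\<And>\<sigma>. \<sigma>\<^sub>0 < \<sigma> \<Longrightarrow> complex_of_real \<sigma> \<in> W"
    and eq: "\<And>s. s \<in> W \<Longrightarrow> c < Re s \<Longrightarrow> E s = transform f s"
    and \<sigma>: "\<sigma>\<^sub>0 < \<sigma>"
  shows "converges f \<sigma>"
proof (rule ccontr)
  assume not_conv: "\<not> converges f \<sigma>"
  define S where "S = {\<tau>. converges f \<tau>}"
  \<comment> \<open>The abscissa of convergence. Failure at \<open>\<sigma>\<close> makes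
    \<open>\<sigma>\<close> a lower bound of \<open>S\<close>, so \<open>\<alpha>\<close> lies to
    the right of \<open>\<sigma>\<^sub>0\<close>, where \<open>E\<close> is available.\<close>
  define \<alpha> where "\<alpha> = Inf S"
  have lb: "\<sigma> \<le> \<tau>" if "\<tau> \<in> S" for \<tau>
    using converges_mono[OF assms(1), of \<tau> \<sigma>] that not_conv by (force simp: S_def)
  have bdd: "bdd_below S" and ne: "S \<noteq> {}"
    using lb conv by (auto simp: bdd_below_def S_def)
  have \<alpha>: "\<sigma> \<le> \<alpha>"
    unfolding \<alpha>_def using ne lb by (intro cInf_greatest) auto
  have conv\<alpha>: "converges f \<tau>" if less: "\<alpha> < \<tau>" for \<tau>
  proof -
    obtain \<tau>' where "\<tau>' \<in> S" "\<tau>' < \<tau>"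
      using cInf_lessD[OF ne, of \<tau>] less by (auto simp: \<alpha>_def)
    then show ?thesis
      using converges_mono[OF assms(1), of \<tau>' \<tau>] by (simp add: S_def)
  qed
  have "complex_of_real \<alpha> \<in> W"
    using W(3) \<sigma> \<alpha> by simp
  then obtain \<rho> where \<rho>: "\<rho> > 0" "ball (complex_of_real \<alpha>) \<rho> \<subseteq> W"
    using W(1) open_contains_ball by blast
  \<comment> \<open>The disc of radius \<open>\<rho> / 2\<close> about this centre stays inside the
    ball of radius \<open>\<rho>\<close> about \<open>\<alpha>\<close>, while a step of
    \<open>\<rho> / 3\<close> to the left goes past \<open>\<alpha>\<close>.\<close>
  define \<beta> where "\<beta> = \<alpha> + \<rho> / 4"
  define b where "b = complex_of_real \<beta>"
  define W' where "W' = W \<inter> {s. \<alpha> < Re s}"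
  \<comment> \<open>\<open>W'\<close> may be disconnected. The component of \<open>b\<close>
    contains the real ray to the right of \<open>\<alpha>\<close>, hence points with
    \<open>c < Re s\<close>, where \<open>E\<close> is the transform; the identity theorem applies
    on this component.\<close>
  define W'' where "W'' = connected_component_set W' b"
  have "open W'"
    using W(1) by (simp add: W'_def open_Int open_halfspace_Re_gt)
  then have W'': "open W''" "connected W''"
    by (simp_all add: W''_def open_connected_component)
  have sub: "W'' \<subseteq> W'"
    by (simp add: W''_def connected_component_subset)
  have "b \<in> W'"
    using W(3)[of \<beta>] \<alpha> \<sigma> \<rho> by (simp add: W'_def b_def \<beta>_def)
  have ray: "complex_of_real ` {\<alpha><..} \<subseteq> W''"
    unfolding W''_def
  proof (rule connected_component_maximal)
    show "connected (complex_of_real ` {\<alpha><..})"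
      by (intro connected_continuous_image continuous_intros) simp
    show "complex_of_real ` {\<alpha><..} \<subseteq> W'"
      using W(3) \<alpha> \<sigma> by (auto simp: W'_def)
    show "b \<in> complex_of_real ` {\<alpha><..}"
      using \<rho> by (simp add: b_def \<beta>_def image_eqI[of _ _ "\<alpha> + \<rho> / 4"])
  qed
  have E_eq: "E s = transform f s" if "s \<in> W''" for s
  proof (rule analytic_continuation_open[of "W'' \<inter> {s. c < Re s}" W'' E "transform f"])
    show "W'' \<inter> {s. c < Re s} \<noteq> {}"
    proof -
      have "complex_of_real (max \<alpha> c + 1) \<in> W''"
        by (rule subsetD[OF ray]) (rule imageI, simp)
      moreover have "c < Re (complex_of_real (max \<alpha> c + 1))"
        by simp
      ultimately show ?thesis by blast
    qed
    show "E holomorphic_on W''"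
      using W(2) by (rule holomorphic_on_subset) (use sub in \<open>auto simp: W'_def\<close>)
    show "transform f holomorphic_on W''"
      using transform_holomorphic[OF assms(1) conv\<alpha>]
      by (rule holomorphic_on_subset) (use sub in \<open>auto simp: W'_def\<close>)
  qed (use W'' that eq sub in \<open>auto simp: W'_def open_halfspace_Re_gt\<close>)
  \<comment> \<open>These are the absolute values of the Taylor coefficients at \<open>b\<close>;
    the sign \<open>(- 1) ^ n\<close> in \<open>F\<close> comes from
    \<open>(- L x) ^ n\<close>.\<close>
  define a where "a = (\<lambda>n. LINT x|M. f x * exp (- (\<beta> * L x)) * (L x ^ n / fact n))"
  define F where "F = Abs_fps (\<lambda>n. (- 1) ^ n * complex_of_real (a n))"
  have coeff: "(LINT x|M. of_real (f x) * exp (- (b * of_real (L x))) * ((- of_real (L x)) ^ n / fact n))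
      = fps_nth F n" for n
  proof -
    have "(LINT x|M. of_real (f x) * exp (- (b * of_real (L x))) * ((- of_real (L x)) ^ n / fact n)) =
       (LINT x|M. (- 1) ^ n * complex_of_real (f x * exp (- (\<beta> * L x)) * (L x ^ n / fact n)))"
      by (intro Bochner_Integration.integral_cong)
         (simp_all add: b_def power_minus[of "complex_of_real _"] mult_ac flip: exp_of_real)
    then show ?thesis
      by (simp only: F_def a_def fps_nth_Abs_fps integral_mult_right_zero integral_complex_of_real)
  qed
  \<comment> \<open>Convergence at \<open>\<alpha> + \<rho> / 8\<close> leaves room
    \<open>\<rho> / 8\<close> below \<open>\<beta>\<close>. This small disc identifies the Taylor
    series; holomorphy of \<open>E\<close> then enlarges its radius.\<close>
  have series: "(\<lambda>n. fps_nth F n * w ^ n) sums transform f (b + w)" if "norm w < \<rho> / 8" for w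
    unfolding coeff[symmetric]
    by (rule transform_power_series[OF assms(1) conv\<alpha>[of "\<alpha> + \<rho> / 8"]])
       (use that \<rho> in \<open>simp_all add: b_def \<beta>_def\<close>)
  have "b \<in> W''"
    using \<open>b \<in> W'\<close> by (simp add: W''_def)
  then obtain e where e: "e > 0" "ball b e \<subseteq> W''"
    using W''(1) open_contains_ball by blast
  have fps: "(\<lambda>w. E (b + w)) has_fps_expansion F"
  proof (rule has_fps_expansionI)
    have "eventually (\<lambda>w. w \<in> ball 0 (min e (\<rho> / 8))) (nhds (0::complex))"
      using e \<rho> by (intro eventually_nhds_in_open) auto
    then show "\<forall>\<^sub>F w in nhds 0. (\<lambda>n. fps_nth F n * w ^ n) sums E (b + w)"
    proof eventually_elim
      case (elim w)
      then have "b + w \<in> W''"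
        using e(2) by (auto simp: dist_norm subset_iff)
      then show ?case
        using series[of w] elim E_eq by simp
    qed
  qed
  have "(\<lambda>w. E (b + w)) holomorphic_on eball 0 (\<rho> / 2)"
  proof -
    have "(E \<circ> (\<lambda>w. b + w)) holomorphic_on eball 0 (\<rho> / 2)"
    proof (rule holomorphic_on_compose_gen)
      show "(\<lambda>w. b + w) ` eball 0 (ereal (\<rho> / 2)) \<subseteq> W"
      proof (rule subset_trans[OF _ \<rho>(2)], safe)
        fix w :: complex assume "w \<in> eball 0 (ereal (\<rho> / 2))"
        then have "norm w < \<rho> / 2" by simp
        moreover have "norm (complex_of_real \<alpha> - (b + w)) \<le> \<rho> / 4 + norm w"
          using norm_triangle_ineq[of "- complex_of_real (\<rho> / 4)" "- w"] \<rho>(1)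
          by (simp add: b_def \<beta>_def)
        ultimately show "b + w \<in> ball (complex_of_real \<alpha>) \<rho>"
          using \<rho>(1) by (simp add: dist_norm)
      qed
    qed (use W(2) in \<open>auto intro!: holomorphic_intros\<close>)
    then show ?thesis by (simp add: o_def)
  qed
  then have "ereal (\<rho> / 2) \<le> fps_conv_radius F"
    by (rule holomorphic_on_imp_fps_conv_radius_ge[OF fps])
  then have "ereal (\<rho> / 3) < fps_conv_radius F"
    using \<rho>(1) by (simp add: less_le_trans[of "ereal (\<rho> / 3)" "ereal (\<rho> / 2)"])
  \<comment> \<open>At a negative point the alternating signs cancel, which leaves a convergent
    series of nonnegative terms.\<close>
  then have "summable (\<lambda>n. fps_nth F n * complex_of_real (- \<rho> / 3) ^ n)"
    using \<rho>(1) by (intro summable_fps) simp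
  then have "summable (\<lambda>n. complex_of_real (a n * (\<rho> / 3) ^ n))"
  proof (rule back_subst[of summable], intro ext)
    fix n
    have "(- complex_of_real \<rho> / 3) ^ n = (- 1) ^ n * complex_of_real ((\<rho> / 3) ^ n)"
      using power_minus[of "complex_of_real \<rho> / 3" n] by simp
    then show "fps_nth F n * complex_of_real (- \<rho> / 3) ^ n = complex_of_real (a n * (\<rho> / 3) ^ n)"
      by (simp add: F_def mult.assoc mult.left_commute[of "(- 1) ^ n"] flip: power_mult_distrib)
  qed
  then have summ: "summable (\<lambda>n. a n * (\<rho> / 3) ^ n)"
    by (rule summable_of_real_iff[THEN iffD1])
  define g where "g = (\<lambda>n x. f x * exp (- (\<beta> * L x)) * ((\<rho> / 3 * L x) ^ n / fact n))"
  have g_nonneg: "0 \<le> g n x" if "x \<in> space M" for n x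
    using that nonneg kernel_nonneg \<rho>(1) by (simp add: g_def)
  have g_eq: "g n x = (f x * exp (- (\<beta> * L x)) * (L x ^ n / fact n)) * (\<rho> / 3) ^ n" for n x
    unfolding g_def power_mult_distrib by (simp only: mult_ac times_divide_eq_right times_divide_eq_left)
  have g_sums: "(\<lambda>n. g n x) sums (f x * exp (- ((\<beta> - \<rho> / 3) * L x)))" for x
    unfolding g_def by (rule exp_weight_sums)
  have int_f: "integrable M (\<lambda>x. f x * exp (- ((\<beta> - \<rho> / 8) * L x)))"
    using conv\<alpha>[of "\<beta> - \<rho> / 8"] \<rho>(1) by (simp add: converges_def \<beta>_def)
  have int_g: "integrable M (g n)" for n
  proof -
    \<comment> \<open>With \<open>\<rho> / 8\<close> in place of \<open>\<rho> / 3\<close> the term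
      is dominated by the integrable function in \<open>int_f\<close>; the constant
      \<open>(8 / 3) ^ n\<close> then rescales it.\<close>
    have "integrable M (\<lambda>x. f x * exp (- (\<beta> * L x)) * ((\<rho> / 8 * L x) ^ n / fact n))" (is "integrable M ?h")
    proof (rule Bochner_Integration.integrable_bound[OF int_f])
      show "AE x in M. norm (?h x) \<le> norm (f x * exp (- ((\<beta> - \<rho> / 8) * L x)))"
      proof (rule AE_I2)
        fix x assume x: "x \<in> space M"
        let ?t = "\<lambda>n. f x * exp (- (\<beta> * L x)) * ((\<rho> / 8 * L x) ^ n / fact n)"
        have t_nonneg: "0 \<le> ?t n" for n
          using nonneg[OF x] kernel_nonneg[OF x] \<rho>(1) by simp
        have "?t n \<le> (\<Sum>n. ?t n)"
          using sum_le_suminf[of ?t "{n}", OF sums_summable[OF exp_weight_sums]] t_nonneg by simp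
        also have "\<dots> = f x * exp (- ((\<beta> - \<rho> / 8) * L x))"
          by (rule sums_unique[OF exp_weight_sums, symmetric])
        finally show "norm (?h x) \<le> norm (f x * exp (- ((\<beta> - \<rho> / 8) * L x)))"
          using t_nonneg[of n] by simp
      qed
    qed measurable
    then have "integrable M (\<lambda>x. (8 / 3) ^ n * ?h x)"
      by (rule integrable_mult_right)
    moreover have "(8 / 3) ^ n * ?h x = g n x" for x
    proof -
      have "(8 / 3) ^ n * (\<rho> / 8 * L x) ^ n = (\<rho> / 3 * L x) ^ n"
        by (subst power_mult_distrib[symmetric]) simp
      then show ?thesis
        by (simp add: g_def mult.left_commute[of "(8 / 3) ^ n"])
    qed
    ultimately show ?thesis by simp
  qed
  have "integrable M (\<lambda>x. \<Sum>n. g n x)"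
  proof (rule integrable_suminf)
    show "AE x in M. summable (\<lambda>n. norm (g n x))"
      using g_sums by (intro AE_I2) (simp add: g_nonneg sums_iff)
    have "(LINT x|M. norm (g n x)) = a n * (\<rho> / 3) ^ n" for n
    proof -
      have "(LINT x|M. norm (g n x)) = (LINT x|M. g n x)"
        by (intro Bochner_Integration.integral_cong) (auto simp: g_nonneg)
      then show ?thesis
        by (simp add: g_eq a_def)
    qed
    then show "summable (\<lambda>n. LINT x|M. norm (g n x))"
      using summ by simp
  qed (rule int_g)
  \<comment> \<open>This abscissa is \<open>\<alpha> - \<rho> / 12\<close>, below the infimum of
    \<open>S\<close>.\<close>
  then have "\<beta> - \<rho> / 3 \<in> S"
    using sums_unique[OF g_sums] by (simp add: S_def converges_def)
  then have "\<alpha> \<le> \<beta> - \<rho> / 3"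
    unfolding \<alpha>_def using bdd by (rule cInf_lower)
  then show False
    using \<rho>(1) by (simp add: \<beta>_def)
qed

end

section \<open>Continuation of one-sided bounds\<close>

text \<open>Off a sparse set, \<open>A - H\<close> either vanishes or avoids 0, and agreement on
  \<open>T\<close> excludes the latter. Near \<open>z\<close> the function \<open>A\<close> then has
  the finite limit \<open>H z\<close>, so there is no pole, and the normalised values of a nicely
  meromorphic function give equality at \<open>z\<close> itself.\<close>

lemma nicely_meromorphic_identity:
  assumes A: "A nicely_meromorphic_on S" and H: "H holomorphic_on S"
    and S: "open S" "connected S" and T: "open T" "T \<noteq> {}" "T \<subseteq> S" "\<And>z. z \<in> T \<Longrightarrow> A z = H z"
    and z: "z \<in> S"
  shows "A z = H z"
proof -
  have anH: "H analytic_on S"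
    using H S(1) by (simp add: analytic_on_open)
  have "(\<lambda>z. A z - H z) meromorphic_on S"
    using A analytic_on_imp_meromorphic_on[OF anH]
    by (auto simp: nicely_meromorphic_on_def intro: meromorphic_on_diff)
  from meromorphic_imp_constant_or_avoid[OF this S, of 0]
  have "eventually (\<lambda>z. A z - H z = 0) (cosparse S)"
  proof
    assume "eventually (\<lambda>z. A z - H z \<noteq> 0) (cosparse S)"
    moreover obtain t where t: "t \<in> T"
      using T(2) by blast
    ultimately have "eventually (\<lambda>z. A z - H z \<noteq> 0) (at t)"
      using S(1) T(3) by (auto simp: eventually_cosparse_open_eq)
    moreover have "eventually (\<lambda>z. z \<in> T) (at t)"
      using T(1) t by (rule eventually_at_in_open')
    ultimately have "eventually (\<lambda>z. False) (at t)"
      by eventually_elim (use T(4) in auto)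
    then show ?thesis by simp
  qed
  then have ev: "eventually (\<lambda>w. A w = H w) (at z)"
    using S(1) z by (auto simp: eventually_cosparse_open_eq)
  have "H \<midarrow>z\<rightarrow> H z"
    using anH z S(1) H by (metis analytic_at_imp_isCont analytic_on_analytic_at isContD)
  then have lim: "A \<midarrow>z\<rightarrow> H z"
    using tendsto_cong[OF ev] by blast
  then have "\<not> is_pole A z"
    using not_tendsto_and_filterlim_at_infinity[of "at z" A] by (auto simp: is_pole_def)
  then have "A \<midarrow>z\<rightarrow> A z"
    using A z by (auto simp: nicely_meromorphic_on_def)
  then show ?thesis
    using lim by (rule LIM_unique)
qed

context laplace_kernel
begin

text \<open>
  A majorant \<open>c\<^sub>0 k + g\<close> of \<open>\<phi>\<close> makes \<open>c\<^sub>0 k + g - \<phi>\<close> nonnegative, so that its transform \<open>B\<close>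
  converges up to the first real singularity and satisfies \<open>\<bar>B(\<sigma> + it)\<bar> \<le> B(\<sigma>)\<close>.
\<close>

lemma norm_continuation_le:
  assumes [measurable]: "\<phi> \<in> borel_measurable M" "g \<in> borel_measurable M" "k \<in> borel_measurable M"
    and g_nonneg: "\<And>x. x \<in> space M \<Longrightarrow> 0 \<le> g x"
    and majorant: "\<And>x. x \<in> space M \<Longrightarrow> \<phi> x \<le> c\<^sub>0 * k x + g x" and c\<^sub>0: "0 \<le> c\<^sub>0"
    and conv_g: "\<And>\<sigma>. \<sigma>\<^sub>0 < \<sigma> \<Longrightarrow> converges g \<sigma>" and conv_k: "\<And>\<sigma>. \<sigma>\<^sub>0 < \<sigma> \<Longrightarrow> converges k \<sigma>"
    and k: "\<And>s. \<sigma>\<^sub>0 < Re s \<Longrightarrow> transform k s = 1 / (s - of_real \<sigma>\<^sub>0)"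
    and A: "A nicely_meromorphic_on U" and U: "open U" "connected (U \<inter> {s. \<sigma>\<^sub>0 < Re s})"
    and V: "open V" "A analytic_on V" "\<And>\<sigma>. \<sigma>\<^sub>0 < \<sigma> \<Longrightarrow> complex_of_real \<sigma> \<in> V" "V \<subseteq> U"
    and conv_\<phi>: "converges \<phi> c"
    and A_eq: "\<And>s. c < Re s \<Longrightarrow> s \<in> U \<and> A s = transform \<phi> s"
    and \<sigma>: "\<sigma>\<^sub>0 < \<sigma>" and t: "Complex \<sigma> t \<in> U"
  shows "norm (A (Complex \<sigma> t)) \<le> c\<^sub>0 / norm (Complex (\<sigma> - \<sigma>\<^sub>0) t) + c\<^sub>0 / (\<sigma> - \<sigma>\<^sub>0)
    + 2 * (LINT x|M. g x * exp (- (\<sigma> * L x))) - Re (A (of_real \<sigma>))"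
proof -
  define f where "f = (\<lambda>x. c\<^sub>0 * k x + g x - \<phi> x)"
  have [measurable]: "f \<in> borel_measurable M"
    unfolding f_def by measurable
  have f_nonneg: "0 \<le> f x" if "x \<in> space M" for x
    using majorant[OF that] by (simp add: f_def)
  \<comment> \<open>The transform of the majorant, with the part from \<open>k\<close> in closed
    form, so that \<open>P - A\<close> continues the transform of \<open>f\<close>.\<close>
  define P where "P = (\<lambda>s. of_real c\<^sub>0 / (s - of_real \<sigma>\<^sub>0) + transform g s)"
  have split: "converges f \<tau>" if "\<sigma>\<^sub>0 < \<tau>" "converges \<phi> \<tau>" for \<tau>
    using conv_g[OF that(1)] conv_k[OF that(1)] that(2)
      Bochner_Integration.integrable_diff[OF Bochner_Integration.integrable_add]
    by (simp add: converges_def f_def algebra_simps)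
  have transform_f: "transform f s = P s - transform \<phi> s" if "\<sigma>\<^sub>0 < Re s" "converges \<phi> (Re s)" for s
  proof -
    note int = integrable_transform[OF assms(1) that(2)]
      integrable_transform[OF assms(2) conv_g[OF that(1)]] integrable_transform[OF assms(3) conv_k[OF that(1)]]
    have "transform f s = (LINT x|M. of_real c\<^sub>0 * (of_real (k x) * exp (- (s * of_real (L x))))
        + of_real (g x) * exp (- (s * of_real (L x))) - of_real (\<phi> x) * exp (- (s * of_real (L x))))"
      unfolding transform_def f_def
      by (intro Bochner_Integration.integral_cong) (simp_all add: algebra_simps)
    also have "\<dots> = of_real c\<^sub>0 * transform k s + transform g s - transform \<phi> s"
      using int by (simp add: transform_def)
    finally show ?thesis
      using k[OF that(1)] by (simp add: P_def)
  qed
  have hol_P: "P holomorphic_on {s. \<sigma>\<^sub>0 < Re s}"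
    unfolding P_def by (intro holomorphic_intros transform_holomorphic[OF assms(2) conv_g]) auto
  define c' where "c' = max c (\<sigma>\<^sub>0 + 1)"
  have c': "c < Re s" "\<sigma>\<^sub>0 < Re s" if "c' < Re s" for s
    using that by (simp_all add: c'_def)
  have conv_\<phi>': "converges \<phi> \<tau>" if "c' < \<tau>" for \<tau>
    using converges_mono[OF assms(1) conv_\<phi>, of \<tau>] that by (simp add: c'_def)
  \<comment> \<open>Landau's theorem asks for a holomorphic continuation around the real half-line
    only. \<open>V\<close> provides it, although \<open>A\<close> is merely meromorphic on
    \<open>U\<close>.\<close>
  have conv_f: "converges f \<tau>" if "\<sigma>\<^sub>0 < \<tau>" for \<tau>
  proof (rule landau_abscissa[where W = "V \<inter> {s. \<sigma>\<^sub>0 < Re s}" and E = "\<lambda>s. P s - A s"])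
    show "converges f (c' + 1)"
      using split[of "c' + 1"] conv_\<phi>'[of "c' + 1"] by (simp add: c'_def)
    show "open (V \<inter> {s. \<sigma>\<^sub>0 < Re s})"
      using V(1) by (simp add: open_Int open_halfspace_Re_gt)
    have "A holomorphic_on V \<inter> {s. \<sigma>\<^sub>0 < Re s}"
      using analytic_imp_holomorphic[OF V(2)] by (rule holomorphic_on_subset) auto
    moreover have "P holomorphic_on V \<inter> {s. \<sigma>\<^sub>0 < Re s}"
      using hol_P by (rule holomorphic_on_subset) auto
    ultimately show "(\<lambda>s. P s - A s) holomorphic_on V \<inter> {s. \<sigma>\<^sub>0 < Re s}"
      by (intro holomorphic_intros)
    show "P s - A s = transform f s" if "c' + 1 < Re s" for s
      using c'[of s] that A_eq[of s] transform_f[of s] conv_\<phi>'[of "Re s"] by simp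
  qed (use V(3) that f_nonneg in auto)
  \<comment> \<open>Convergence of \<open>f\<close> makes the right-hand side holomorphic on the
    whole half-plane, so equality spreads from \<open>c' < Re s\<close> over the connected set
    \<open>U \<inter> {s. \<sigma>\<^sub>0 < Re s}\<close> and reaches points off the real
    axis.\<close>
  have A_P: "A s = P s - transform f s" if "s \<in> U" "\<sigma>\<^sub>0 < Re s" for s
  proof (rule nicely_meromorphic_identity[where A = A and H = "\<lambda>s. P s - transform f s" and S = "U \<inter> {s. \<sigma>\<^sub>0 < Re s}" and T = "{s. c' < Re s}"])
    show "A nicely_meromorphic_on U \<inter> {s. \<sigma>\<^sub>0 < Re s}"
      using A by (rule nicely_meromorphic_on_subset) auto
    have "P holomorphic_on U \<inter> {s. \<sigma>\<^sub>0 < Re s}"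
      using hol_P by (rule holomorphic_on_subset) auto
    moreover have "transform f holomorphic_on U \<inter> {s. \<sigma>\<^sub>0 < Re s}"
      using transform_holomorphic[of f, OF _ conv_f] by (rule holomorphic_on_subset) auto
    ultimately show "(\<lambda>s. P s - transform f s) holomorphic_on U \<inter> {s. \<sigma>\<^sub>0 < Re s}"
      by (intro holomorphic_intros)
    show "{s. c' < Re s} \<noteq> {}"
      by (auto intro: exI[of _ "complex_of_real (c' + 1)"])
    show "{s. c' < Re s} \<subseteq> U \<inter> {s. \<sigma>\<^sub>0 < Re s}"
      using A_eq by (auto simp: c'_def)
    show "A s = P s - transform f s" if "s \<in> {s. c' < Re s}" for s
      using c'[of s] that A_eq[of s] transform_f[of s] conv_\<phi>'[of "Re s"] by simp
  qed (use that U in \<open>auto simp: open_Int open_halfspace_Re_gt\<close>)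
  define G where "G = (LINT x|M. g x * exp (- (\<sigma> * L x)))"
  have "complex_of_real \<sigma> \<in> U"
    using V(3)[OF \<sigma>] V(4) by auto
  then have "complex_of_real (LINT x|M. f x * exp (- (\<sigma> * L x))) = P \<sigma> - A \<sigma>"
    using A_P[of "of_real \<sigma>"] \<sigma> by (simp add: transform_of_real)
  then have "(LINT x|M. f x * exp (- (\<sigma> * L x))) = Re (P \<sigma> - A \<sigma>)"
    by (metis Re_complex_of_real)
  also have "P \<sigma> = of_real (c\<^sub>0 / (\<sigma> - \<sigma>\<^sub>0) + G)"
    by (simp add: P_def transform_of_real G_def)
  finally have f_int: "(LINT x|M. f x * exp (- (\<sigma> * L x))) = c\<^sub>0 / (\<sigma> - \<sigma>\<^sub>0) + G - Re (A \<sigma>)"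
    by simp
  \<comment> \<open>The transform of the nonnegative \<open>f\<close> is largest in modulus on the
    real axis, where it equals \<open>P - A\<close>. One \<open>G\<close> comes from that value and
    one from \<open>P (Complex \<sigma> t)\<close>, whence the factor 2.\<close>
  have "norm (A (Complex \<sigma> t)) \<le> norm (P (Complex \<sigma> t)) + norm (transform f (Complex \<sigma> t))"
    using A_P[OF t] \<sigma> norm_triangle_ineq4 by simp
  also have "norm (transform f (Complex \<sigma> t)) \<le> c\<^sub>0 / (\<sigma> - \<sigma>\<^sub>0) + G - Re (A \<sigma>)"
    using norm_transform_le[of f "Complex \<sigma> t"] f_nonneg f_int by simp
  also have "norm (P (Complex \<sigma> t)) \<le> norm (of_real c\<^sub>0 / (Complex \<sigma> t - of_real \<sigma>\<^sub>0)) + norm (transform g (Complex \<sigma> t))"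
    unfolding P_def by (rule norm_triangle_ineq)
  also have "norm (transform g (Complex \<sigma> t)) \<le> G"
    using norm_transform_le[of g "Complex \<sigma> t"] g_nonneg by (simp add: G_def)
  also have "norm (of_real c\<^sub>0 / (Complex \<sigma> t - of_real \<sigma>\<^sub>0)) = c\<^sub>0 / norm (Complex (\<sigma> - \<sigma>\<^sub>0) t)"
  proof -
    have "Complex \<sigma> t - of_real \<sigma>\<^sub>0 = Complex (\<sigma> - \<sigma>\<^sub>0) t"
      by (simp add: complex_eq_iff)
    then show ?thesis
      using c\<^sub>0 by (simp add: norm_divide)
  qed
  finally show ?thesis
    unfolding G_def by linarith
qed

end

section \<open>Functions of small mass on dyadic blocks\<close>

text \<open>An Abelian estimate: the geometric sum is of order \<open>1 / \<eta>\<close>, so after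
  multiplication by \<open>\<eta>\<close> a tail with \<open>v k \<le> \<delta>\<close> contributes
  \<open>O(\<delta>)\<close>, and the finitely many earlier terms contribute
  \<open>O(\<eta>)\<close>.\<close>

lemma abel_sum_small:
  fixes v :: "nat \<Rightarrow> real"
  assumes v: "v \<longlonglongrightarrow> 0" and nonneg: "\<And>k. 0 \<le> v k"
  shows "((\<lambda>\<eta>. \<eta> * (\<Sum>k. v k * (2 powr - \<eta>) ^ k)) \<longlongrightarrow> 0) (at_right 0)"
    and "0 < \<eta> \<Longrightarrow> summable (\<lambda>k. v k * (2 powr - \<eta>) ^ k)"
proof -
  define q :: "real \<Rightarrow> real" where "q = (\<lambda>\<eta>. 2 powr - \<eta>)"
  have q: "0 < q \<eta>" "q \<eta> < 1" if "0 < \<eta>" for \<eta>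
    using that powr_less_mono[of "- \<eta>" 0 2] by (auto simp: q_def)
  \<comment> \<open>This rests on \<open>exp y \<ge> 1 + y\<close> at
    \<open>y = \<eta> * ln 2\<close>, where \<open>q \<eta> = exp (- y)\<close>.\<close>
  have q_le: "\<eta> / (1 - q \<eta>) \<le> 1 / ln 2 + \<eta>" if "0 < \<eta>" for \<eta>
  proof -
    have l: "0 < ln (2::real)" by simp
    have "1 + \<eta> * ln 2 \<le> exp (\<eta> * ln 2)"
      by (rule exp_ge_add_one_self)
    then have "q \<eta> * (1 + \<eta> * ln 2) \<le> q \<eta> * exp (\<eta> * ln 2)"
      using q[OF that] by (intro mult_left_mono) auto
    also have "\<dots> = 1"
      by (simp add: q_def powr_def flip: exp_add)
    finally have "\<eta> * ln 2 \<le> (1 - q \<eta>) * (1 + \<eta> * ln 2)"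
      by (simp add: algebra_simps)
    then show ?thesis
      using q[OF that] l by (simp add: field_simps)
  qed
  obtain B where B: "\<And>k. v k \<le> B"
    using convergent_imp_Bseq[OF convergentI[OF v]] by (auto simp: Bseq_def abs_le_iff)
  have geo: "summable (\<lambda>k. q \<eta> ^ k)" "(\<Sum>k. q \<eta> ^ k) = 1 / (1 - q \<eta>)" if "0 < \<eta>" for \<eta>
    using q[OF that] by (auto simp: suminf_geometric)
  have summ: "summable (\<lambda>k. v k * q \<eta> ^ k)" if "0 < \<eta>" for \<eta>
  proof (rule summable_comparison_test'[where g = "\<lambda>k. B * q \<eta> ^ k" and N = 0])
    show "norm (v k * q \<eta> ^ k) \<le> B * q \<eta> ^ k" for k
      using B[of k] nonneg[of k] q[OF that] by (simp add: abs_mult mult_right_mono)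
  qed (rule summable_mult[OF geo(1)[OF that]])
  then show "summable (\<lambda>k. v k * (2 powr - \<eta>) ^ k)" if "0 < \<eta>"
    using that by (simp add: q_def)
  show "((\<lambda>\<eta>. \<eta> * (\<Sum>k. v k * (2 powr - \<eta>) ^ k)) \<longlongrightarrow> 0) (at_right 0)"
  proof (rule tendstoI)
    fix e :: real assume e: "0 < e"
    define C where "C = 1 / ln 2 + (1 :: real)"
    have C: "0 < C" unfolding C_def by (intro add_pos_pos) auto
    \<comment> \<open>For \<open>\<eta> \<le> 1\<close> the quotient
      \<open>\<eta> / (1 - q \<eta>)\<close> is at most \<open>C\<close>, so the tail costs at most
      \<open>e / 2\<close>. The choice of \<open>\<eta>\<^sub>0\<close> does the same for the head,
      with \<open>S + 1\<close> guarding against \<open>S = 0\<close>.\<close>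
    define \<delta> where "\<delta> = e / (2 * C)"
    have \<delta>: "0 < \<delta>" using e C by (simp add: \<delta>_def)
    obtain K where K: "\<And>k. k \<ge> K \<Longrightarrow> v k \<le> \<delta>"
      using order_tendstoD(2)[OF v \<delta>] by (auto simp: eventually_sequentially intro: less_imp_le)
    define S where "S = (\<Sum>k<K. v k)"
    have S: "0 \<le> S" using nonneg by (simp add: S_def sum_nonneg)
    define \<eta>\<^sub>0 where "\<eta>\<^sub>0 = min 1 (e / (2 * (S + 1)))"
    have \<eta>\<^sub>0: "0 < \<eta>\<^sub>0" using e S by (simp add: \<eta>\<^sub>0_def)
    have "dist (\<eta> * (\<Sum>k. v k * (2 powr - \<eta>) ^ k)) 0 < e" if \<eta>: "0 < \<eta>" "\<eta> < \<eta>\<^sub>0" for \<eta>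
    proof -
      have "(\<Sum>k. v k * q \<eta> ^ k) \<le> (\<Sum>k. (if k < K then v k else 0) + \<delta> * q \<eta> ^ k)"
      proof (rule suminf_le)
        show "v k * q \<eta> ^ k \<le> (if k < K then v k else 0) + \<delta> * q \<eta> ^ k" for k
        proof (cases "k < K")
          case True
          have "v k * q \<eta> ^ k \<le> v k * 1"
            using q[OF \<eta>(1)] nonneg[of k] by (intro mult_left_mono power_le_one) auto
          moreover have "0 \<le> \<delta> * q \<eta> ^ k"
            using q[OF \<eta>(1)] \<delta> by simp
          ultimately show ?thesis using True by simp
        next
          case False
          then show ?thesis
            using q[OF \<eta>(1)] K[of k] by (simp add: mult_right_mono)
        qed
        show "summable (\<lambda>k. (if k < K then v k else 0) + \<delta> * q \<eta> ^ k)"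
          using geo(1)[OF \<eta>(1)]
          by (intro summable_add summable_mult) (auto intro: summable_finite[of "{..<K}"])
      qed (rule summ[OF \<eta>(1)])
      also have "\<dots> = (\<Sum>k. if k < K then v k else 0) + (\<Sum>k. \<delta> * q \<eta> ^ k)"
        using geo(1)[OF \<eta>(1)]
        by (intro suminf_add[symmetric] summable_mult) (auto intro: summable_finite[of "{..<K}"])
      also have "(\<Sum>k. if k < K then v k else 0) = S"
        by (subst suminf_finite[of "{..<K}"]) (auto simp: S_def)
      also have "(\<Sum>k. \<delta> * q \<eta> ^ k) = \<delta> * (1 / (1 - q \<eta>))"
        using geo[OF \<eta>(1)] by (simp add: suminf_mult)
      finally have "\<eta> * (\<Sum>k. v k * q \<eta> ^ k) \<le> \<eta> * (S + \<delta> * (1 / (1 - q \<eta>)))"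
        using \<eta>(1) by (intro mult_left_mono) auto
      also have "\<dots> = \<eta> * S + \<delta> * (\<eta> / (1 - q \<eta>))"
        by (simp add: algebra_simps)
      also have "\<delta> * (\<eta> / (1 - q \<eta>)) \<le> \<delta> * C"
        using q_le[OF \<eta>(1)] \<eta>(2) \<delta> by (intro mult_left_mono) (auto simp: \<eta>\<^sub>0_def C_def)
      also have "\<dots> = e / 2"
        using C by (simp add: \<delta>_def)
      also have "\<eta> * S < e / 2"
      proof -
        have "\<eta> * S \<le> \<eta> * (S + 1)"
          using \<eta>(1) by (intro mult_left_mono) auto
        also have "\<dots> < e / (2 * (S + 1)) * (S + 1)"
          using \<eta> S by (intro mult_strict_right_mono) (auto simp: \<eta>\<^sub>0_def)
        also have "\<dots> = e / 2" using S by (simp add: field_simps)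
        finally show ?thesis .
      qed
      finally have "\<eta> * (\<Sum>k. v k * q \<eta> ^ k) < e" by simp
      moreover have "0 \<le> \<eta> * (\<Sum>k. v k * q \<eta> ^ k)"
        using \<eta>(1) nonneg q[OF \<eta>(1)] summ[OF \<eta>(1)] by (intro mult_nonneg_nonneg suminf_nonneg) auto
      ultimately show ?thesis
        by (simp add: q_def dist_real_def)
    qed
    then show "\<forall>\<^sub>F \<eta> in at_right 0. dist (\<eta> * (\<Sum>k. v k * (2 powr - \<eta>) ^ k)) 0 < e"
      using \<eta>\<^sub>0 by (auto simp: eventually_at_right[of 0 1])
  qed
qed

text \<open>The blocks \<open>[2 ^ k, 2 * 2 ^ k]\<close> cover \<open>[1, \<infinity>)\<close>, and
  on each the surplus decay \<open>x powr - (\<sigma> - \<sigma>\<^sub>0)\<close> is at most its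
  value at the left end. Shared endpoints do no harm to an upper bound.\<close>

lemma dyadic_nn_integral_le:
  fixes g :: "real \<Rightarrow> real"
  assumes [measurable]: "g \<in> borel_measurable lborel" and g_nonneg: "\<And>x. 0 \<le> g x"
    and v: "v \<longlonglongrightarrow> 0" "\<And>k. 0 \<le> v k"
    and block: "\<And>k. (\<integral>\<^sup>+x\<in>{2 ^ k..2 * 2 ^ k}. ennreal (g x * x powr - \<sigma>\<^sub>0) \<partial>lborel) \<le> ennreal (v k)"
    and \<sigma>: "\<sigma>\<^sub>0 < \<sigma>"
  shows "(\<integral>\<^sup>+x\<in>{1..}. ennreal (g x * x powr - \<sigma>) \<partial>lborel)
    \<le> ennreal (\<Sum>k. v k * (2 powr - (\<sigma> - \<sigma>\<^sub>0)) ^ k)"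
proof -
  define q where "q = (2::real) powr - (\<sigma> - \<sigma>\<^sub>0)"
  define w where "w = (\<lambda>(k::nat) x. ennreal (q ^ k) * (ennreal (g x * x powr - \<sigma>\<^sub>0) * indicator {2 ^ k..2 * 2 ^ k} x))"
  have q: "0 < q" by (simp add: q_def)
  have "(\<integral>\<^sup>+x\<in>{1..}. ennreal (g x * x powr - \<sigma>) \<partial>lborel) \<le> (\<integral>\<^sup>+x. (\<Sum>k. w k x) \<partial>lborel)"
  proof (intro nn_integral_mono)
    fix x :: real
    show "ennreal (g x * x powr - \<sigma>) * indicator {1..} x \<le> (\<Sum>k. w k x)"
    proof (cases "1 \<le> x")
      case True
      define k where "k = nat \<lfloor>log 2 x\<rfloor>"
      have k: "real k \<le> log 2 x" "log 2 x < real k + 1"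
        using True by (simp_all add: k_def)
      have x: "2 ^ k \<le> x" "x \<le> 2 * 2 ^ k"
        using k True by (simp_all add: le_log_iff log_less_iff powr_add powr_realpow less_imp_le)
      have "x powr - (\<sigma> - \<sigma>\<^sub>0) \<le> (2 ^ k) powr - (\<sigma> - \<sigma>\<^sub>0)"
        using x \<sigma> by (intro powr_mono2') auto
      also have "\<dots> = q ^ k"
        by (simp add: q_def powr_powr mult.commute flip: powr_realpow)
      finally have "x powr - \<sigma> \<le> q ^ k * x powr - \<sigma>\<^sub>0"
        using mult_right_mono[of "x powr - (\<sigma> - \<sigma>\<^sub>0)" "q ^ k" "x powr - \<sigma>\<^sub>0"] by (simp flip: powr_add)
      then have "g x * x powr - \<sigma> \<le> q ^ k * (g x * x powr - \<sigma>\<^sub>0)"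
        using mult_left_mono[OF _ g_nonneg[of x]] by (simp add: mult.left_commute)
      then have "ennreal (g x * x powr - \<sigma>) * indicator {1..} x \<le> w k x"
        using True x q by (simp add: w_def ennreal_mult''[symmetric] ennreal_leI g_nonneg flip: ennreal_mult)
      also have "\<dots> \<le> (\<Sum>k. w k x)"
        using sum_le_suminf[of "\<lambda>k. w k x" "{k}"] by simp
      finally show ?thesis .
    qed simp
  qed
  also have "\<dots> = (\<Sum>k. \<integral>\<^sup>+x. w k x \<partial>lborel)"
    unfolding w_def by (intro nn_integral_suminf) measurable
  also have "\<dots> \<le> (\<Sum>k. ennreal (v k * q ^ k))"
  proof (intro suminf_le)
    fix k
    have "(\<integral>\<^sup>+x. w k x \<partial>lborel) = ennreal (q ^ k) * (\<integral>\<^sup>+x\<in>{2 ^ k..2 * 2 ^ k}. ennreal (g x * x powr - \<sigma>\<^sub>0) \<partial>lborel)"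
      unfolding w_def by (intro nn_integral_cmult) measurable
    also have "\<dots> \<le> ennreal (q ^ k) * ennreal (v k)"
      by (intro mult_left_mono block) auto
    finally show "(\<integral>\<^sup>+x. w k x \<partial>lborel) \<le> ennreal (v k * q ^ k)"
      using q v(2) by (simp add: ennreal_mult mult.commute)
  qed auto
  also have "\<dots> = ennreal (\<Sum>k. v k * q ^ k)"
    using v q abel_sum_small(2)[OF v, of "\<sigma> - \<sigma>\<^sub>0"] \<sigma> by (intro suminf_ennreal2) (auto simp: q_def)
  finally show ?thesis
    by (simp add: q_def)
qed

section \<open>Local boundedness of the error term\<close>

text \<open>The residue is a contour integral over a fixed circle on which \<open>D\<close> is
  bounded. Radius and constant are chosen before \<open>h\<close>, which makes the estimate uniform
  over a family of functions.\<close>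

lemma norm_residue_mult_bound:
  assumes D: "isolated_singularity_at D \<rho>" and S: "open S" "\<rho> \<in> S"
  shows "\<exists>e>0. \<exists>C\<ge>0. cball \<rho> e \<subseteq> S \<and> (\<forall>h B. h holomorphic_on S \<longrightarrow>
    (\<forall>s\<in>sphere \<rho> e. norm (h s) \<le> B) \<longrightarrow> norm (residue (\<lambda>s. D s * h s) \<rho>) \<le> C * B)"
proof -
  obtain r\<^sub>1 where r\<^sub>1: "0 < r\<^sub>1" "D analytic_on ball \<rho> r\<^sub>1 - {\<rho>}"
    using D by (auto simp: isolated_singularity_at_def)
  obtain r\<^sub>2 where r\<^sub>2: "0 < r\<^sub>2" "ball \<rho> r\<^sub>2 \<subseteq> S"
    using S open_contains_ball by blast
  define r where "r = min r\<^sub>1 r\<^sub>2"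
  define e where "e = r / 2"
  have e: "0 < e" "cball \<rho> e \<subseteq> ball \<rho> r"
    using r\<^sub>1 r\<^sub>2 by (auto simp: e_def r_def)
  have D_hol: "D holomorphic_on ball \<rho> r - {\<rho>}"
    using analytic_imp_holomorphic[OF r\<^sub>1(2)] by (rule holomorphic_on_subset) (auto simp: r_def)
  have sphere_sub: "sphere \<rho> e \<subseteq> ball \<rho> r - {\<rho>}"
    using e by auto
  have "compact (D ` sphere \<rho> e)"
    by (intro compact_continuous_image continuous_on_subset[OF holomorphic_on_imp_continuous_on[OF D_hol]]
        sphere_sub) auto
  then obtain C where C: "\<And>s. s \<in> sphere \<rho> e \<Longrightarrow> norm (D s) \<le> C"
    using compact_imp_bounded bounded_iff by (metis imageI)
  have bound: "norm (residue (\<lambda>s. D s * h s) \<rho>) \<le> (max C 0 * e) * B"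
    if h: "h holomorphic_on S" "\<forall>s\<in>sphere \<rho> e. norm (h s) \<le> B" for h B
  proof -
    \<comment> \<open>A point on the circle forces \<open>B\<close> to be nonnegative.\<close>
    have "\<rho> + of_real e \<in> sphere \<rho> e"
      using e by (simp add: dist_norm)
    then have B: "0 \<le> B"
      using h(2) norm_ge_zero order_trans by blast
    have "h holomorphic_on ball \<rho> r - {\<rho>}"
      using h(1) by (rule holomorphic_on_subset) (use r\<^sub>2 in \<open>auto simp: r_def\<close>)
    then have "((\<lambda>s. D s * h s) has_contour_integral 2 * pi * \<i> * residue (\<lambda>s. D s * h s) \<rho>) (circlepath \<rho> e)"
      using e by (intro base_residue[of "ball \<rho> r"] holomorphic_intros D_hol) (auto simp: e_def)
    then have "norm (2 * pi * \<i> * residue (\<lambda>s. D s * h s) \<rho>) \<le> (max C 0 * B) * (2 * pi * e)"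
    proof (rule has_contour_integral_bound_circlepath)
      fix s assume "norm (s - \<rho>) = e"
      then have s: "s \<in> sphere \<rho> e"
        by (simp add: dist_norm norm_minus_commute)
      show "norm (D s * h s) \<le> max C 0 * B"
        unfolding norm_mult using C[OF s] h(2) s by (intro mult_mono) auto
    qed (use e B in auto)
    then show ?thesis
      by (simp add: norm_mult mult_ac)
  qed
  have "cball \<rho> e \<subseteq> S"
    using e(2) r\<^sub>2(2) by (auto simp: r_def subset_iff)
  with bound e(1) show ?thesis
    by (intro exI[of _ e] conjI exI[of _ "max C 0 * e"]) auto
qed

text \<open>The residue bound is applied to \<open>h s = x powr s / s\<close>. On the fixed circle
  \<open>norm s > \<sigma>\<^sub>1 > 0\<close>, and the power is bounded for all \<open>x\<close> in
  \<open>[1, X]\<close> at once.\<close>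

lemma main_term_bounded:
  assumes D: "D meromorphic_on {s. \<sigma>\<^sub>1 < Re s}" and \<sigma>\<^sub>1: "0 < \<sigma>\<^sub>1"
  shows "\<exists>B. \<forall>x\<in>{1..X}. norm (main_term D T\<^sub>0 \<sigma>\<^sub>1 x) \<le> B"
proof (cases "finite (pole_set D T\<^sub>0 \<sigma>\<^sub>1)")
  case True
  have "\<exists>B. \<forall>x\<in>{1..X}. norm (residue (\<lambda>s. D s * of_real x powr s / s) \<rho>) \<le> B"
    if \<rho>: "\<rho> \<in> pole_set D T\<^sub>0 \<sigma>\<^sub>1" for \<rho>
  proof -
    define S where "S = {s. \<sigma>\<^sub>1 < Re s}"
    have S: "open S" "\<rho> \<in> S"
      using \<rho> by (auto simp: S_def pole_set_def open_halfspace_Re_gt)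
    have "isolated_singularity_at D \<rho>"
      using meromorphic_on_isolated_singularity[of D \<rho>] meromorphic_on_subset[OF D, of "{\<rho>}"] S(2)
      by (simp add: S_def)
    then obtain e C where e: "0 < e" "0 \<le> C" "cball \<rho> e \<subseteq> S"
      and bound: "\<And>h B. h holomorphic_on S \<Longrightarrow> \<forall>s\<in>sphere \<rho> e. norm (h s) \<le> B \<Longrightarrow>
        norm (residue (\<lambda>s. D s * h s) \<rho>) \<le> C * B"
      using norm_residue_mult_bound[OF _ S, of D] by blast
    have "norm (residue (\<lambda>s. D s * of_real x powr s / s) \<rho>) \<le> C * (X powr (Re \<rho> + e) / \<sigma>\<^sub>1)"
      if x: "x \<in> {1..X}" for x
    proof -
      have "(\<lambda>s. of_real x powr s / s) holomorphic_on S"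
        using \<sigma>\<^sub>1 x by (auto simp: S_def intro!: holomorphic_intros)
      moreover have "norm (of_real x powr s / s) \<le> X powr (Re \<rho> + e) / \<sigma>\<^sub>1" if s: "s \<in> sphere \<rho> e" for s
      proof -
        have "s \<in> S"
          using e s by auto
        then have "\<sigma>\<^sub>1 < norm s"
          using complex_Re_le_cmod[of s] by (simp add: S_def)
        have "Re s \<le> Re \<rho> + e"
          using abs_Re_le_cmod[of "s - \<rho>"] s by (simp add: dist_norm norm_minus_commute)
        then have "x powr Re s \<le> x powr (Re \<rho> + e)"
          using x by (intro powr_mono) auto
        also have "\<dots> \<le> X powr (Re \<rho> + e)"
          using x S(2) e \<sigma>\<^sub>1 by (intro powr_mono2) (auto simp: S_def)
        finally show ?thesis
          using \<open>\<sigma>\<^sub>1 < norm s\<close> \<sigma>\<^sub>1 x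
          by (auto simp: norm_divide norm_powr_real_powr intro!: frac_le)
      qed
      ultimately show ?thesis
        using bound[of "\<lambda>s. of_real x powr s / s" "X powr (Re \<rho> + e) / \<sigma>\<^sub>1"] by simp
    qed
    then show ?thesis by blast
  qed
  then obtain B where B: "\<And>\<rho> x. \<rho> \<in> pole_set D T\<^sub>0 \<sigma>\<^sub>1 \<Longrightarrow> x \<in> {1..X} \<Longrightarrow>
      norm (residue (\<lambda>s. D s * of_real x powr s / s) \<rho>) \<le> B \<rho>"
    by metis
  show ?thesis
    unfolding main_term_def
    by (intro exI[of _ "\<Sum>\<rho>\<in>pole_set D T\<^sub>0 \<sigma>\<^sub>1. B \<rho>"] ballI sum_norm_le B)
\<comment> \<open>Over an infinite index set the sum is 0 by convention.\<close>
qed (auto simp: main_term_def)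

lemma starred_sum_bounded: "\<exists>B. \<forall>x\<in>{1..X}. \<bar>starred_sum a x\<bar> \<le> B"
proof (intro exI ballI)
  fix x assume x: "x \<in> {1..X}"
  define N where "N = nat \<lfloor>X\<rfloor>"
  have sub: "\<bar>sum a I\<bar> \<le> (\<Sum>n\<le>N. \<bar>a n\<bar>)" if "\<And>n. n \<in> I \<Longrightarrow> real n \<le> X" for I
  proof -
    have "I \<subseteq> {..N}"
      using that by (auto simp: N_def le_nat_floor)
    then show ?thesis
      by (intro order_trans[OF sum_abs] sum_mono2) auto
  qed
  have "\<bar>starred_sum a x\<bar> \<le> (\<Sum>n\<le>N. \<bar>a n\<bar>) + \<bar>sum a {nat \<lfloor>x\<rfloor>}\<bar>"
    unfolding starred_sum_def using sub[of "{n. 1 \<le> n \<and> real n < x}"] sub[of "{n. 1 \<le> n \<and> real n \<le> x}"] x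
    by (auto simp: abs_le_iff)
  also have "\<bar>sum a {nat \<lfloor>x\<rfloor>}\<bar> \<le> (\<Sum>n\<le>N. \<bar>a n\<bar>)"
  proof (rule sub)
    show "real n \<le> X" if "n \<in> {nat \<lfloor>x\<rfloor>}" for n
      using that x by (auto intro: order_trans[OF of_int_floor_le])
  qed
  finally show "\<bar>starred_sum a x\<bar> \<le> (\<Sum>n\<le>N. \<bar>a n\<bar>) + (\<Sum>n\<le>N. \<bar>a n\<bar>)"
    by simp
qed

text \<open>Together with measurability, this makes the error term and its square integrable against
  powers on dyadic blocks, so that the mean squares are genuine integrals and not the default value
  0.\<close>

lemma error_term_bounded:
  assumes "dirichlet_setting a D T\<^sub>0 \<sigma>\<^sub>1 \<sigma>\<^sub>2"
  shows "\<exists>B. \<forall>x\<in>{1..X}. \<bar>error_term a D T\<^sub>0 \<sigma>\<^sub>1 x\<bar> \<le> B"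
proof -
  have "D meromorphic_on {s. \<sigma>\<^sub>1 < Re s}" "0 < \<sigma>\<^sub>1"
    using assms by (auto simp: dirichlet_setting_def nicely_meromorphic_on_def)
  from main_term_bounded[OF this] obtain B
    where B: "\<And>x. x \<in> {1..X} \<Longrightarrow> norm (main_term D T\<^sub>0 \<sigma>\<^sub>1 x) \<le> B"
    by blast
  obtain B' where B': "\<And>x. x \<in> {1..X} \<Longrightarrow> \<bar>starred_sum a x\<bar> \<le> B'"
    using starred_sum_bounded by blast
  have "\<bar>error_term a D T\<^sub>0 \<sigma>\<^sub>1 x\<bar> \<le> B' + B" if "x \<in> {1..X}" for x
    using B[OF that] B'[OF that] abs_Re_le_cmod[of "main_term D T\<^sub>0 \<sigma>\<^sub>1 x"]
    unfolding error_term_def by linarith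
  then show ?thesis by blast
qed

section \<open>The Mellin transform\<close>

text \<open>Here \<open>exp (- (s * ln x))\<close> is \<open>x powr - s\<close>. The remaining
  factor \<open>1 / x\<close> of the Mellin kernel goes into the function, which explains the
  divisions by \<open>x\<close> below.\<close>

interpretation mellin: laplace_kernel "restrict_space lborel {1..}" ln
  by unfold_locales (auto simp: space_restrict_space intro: measurable_restrict_space1)

lemma mellin_integrand:
  fixes s :: complex
  assumes "1 \<le> x"
  shows "of_real (f x / x) * exp (- (s * of_real (ln x))) = of_real (f x) * of_real x powr (- s - 1)"
proof -
  have "complex_of_real x powr (- s - 1) = exp (- (s * of_real (ln x)) - of_real (ln x))"
    using assms by (simp add: powr_def Ln_of_real algebra_simps)
  also have "\<dots> = exp (- (s * of_real (ln x))) / of_real x"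
    using assms by (simp add: exp_diff exp_of_real)
  finally show ?thesis
    using assms by simp
qed

lemma mellin_weight:
  fixes x :: real
  assumes "1 \<le> x"
  shows "exp (- (\<sigma> * ln x)) = x powr - \<sigma>"
proof -
  have "x \<noteq> 0" using assms by auto
  then show ?thesis by (simp add: powr_def)
qed

lemma mellin_convergesI:
  fixes f :: "real \<Rightarrow> real"
  assumes [measurable]: "f \<in> borel_measurable lborel" and f: "\<And>x. 0 \<le> f x"
    and R: "0 \<le> R" "(\<integral>\<^sup>+x\<in>{1..}. ennreal (f x * x powr - \<sigma>) \<partial>lborel) \<le> ennreal R"
  shows "mellin.converges f \<sigma>"
    and "(LINT x|restrict_space lborel {1..}. f x * exp (- (\<sigma> * ln x))) \<le> R"
proof -
  have [measurable]: "f \<in> borel_measurable (restrict_space lborel {1..})"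
    by (rule measurable_restrict_space1) simp
  have "(\<integral>\<^sup>+x. ennreal (f x * exp (- (\<sigma> * ln x))) \<partial>restrict_space lborel {1..})
      = (\<integral>\<^sup>+x\<in>{1..}. ennreal (f x * x powr - \<sigma>) \<partial>lborel)"
    by (subst nn_integral_restrict_space) (auto intro!: nn_integral_cong simp: mellin_weight split: split_indicator)
  then have bound: "(\<integral>\<^sup>+x. ennreal (f x * exp (- (\<sigma> * ln x))) \<partial>restrict_space lborel {1..}) \<le> ennreal R"
    using R(2) by simp
  show "mellin.converges f \<sigma>"
    unfolding mellin.converges_def
    using f le_less_trans[OF bound] by (intro integrableI_nonneg) auto
  show "(LINT x|restrict_space lborel {1..}. f x * exp (- (\<sigma> * ln x))) \<le> R"
    using f enn2real_leI[OF R(1) bound] by (subst integral_eq_nn_integral) auto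
qed

lemma nn_integral_powr_atLeast_1:
  assumes "0 < (e::real)"
  shows "(\<integral>\<^sup>+x\<in>{1..}. ennreal (x powr (- e - 1)) \<partial>lborel) = ennreal (1 / e)"
proof -
  have "((\<lambda>x::real. - (x powr - e) / e) \<longlongrightarrow> - 0 / e) at_top"
    using assms by (intro tendsto_intros tendsto_neg_powr filterlim_ident) auto
  moreover have "((\<lambda>x. - (x powr - e) / e) has_real_derivative x powr (- e - 1)) (at x)" if "1 \<le> x" for x
    using that assms by (auto intro!: derivative_eq_intros simp: powr_diff)
  ultimately have "(\<integral>\<^sup>+x\<in>{1..}. ennreal (x powr (- e - 1)) \<partial>lborel) = 0 - (- (1 powr - e) / e)"
    by (intro nn_integral_FTC_atLeast) auto
  then show ?thesis by simp
qed

lemma mellin_converges_powr: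
  assumes "\<sigma>\<^sub>0 < \<sigma>"
  shows "mellin.converges (\<lambda>x. x powr (\<sigma>\<^sub>0 - 1)) \<sigma>"
  using nn_integral_powr_atLeast_1[of "\<sigma> - \<sigma>\<^sub>0"] assms
  by (intro mellin_convergesI(1)[where R = "1 / (\<sigma> - \<sigma>\<^sub>0)"]) (simp_all add: algebra_simps flip: powr_add)

text \<open>The integral is computed at real arguments and carried to the half-plane by the identity
  theorem.\<close>

lemma mellin_transform_powr:
  assumes s: "\<sigma>\<^sub>0 < Re s"
  shows "mellin.transform (\<lambda>x. x powr (\<sigma>\<^sub>0 - 1)) s = 1 / (s - of_real \<sigma>\<^sub>0)"
proof -
  define k where "k = (\<lambda>x::real. x powr (\<sigma>\<^sub>0 - 1))"
  define H where "H = {s. \<sigma>\<^sub>0 < Re s}"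
  have k_meas: "k \<in> borel_measurable (restrict_space lborel {1..})"
    unfolding k_def by (rule measurable_restrict_space1) simp
  have real: "mellin.transform k (of_real \<sigma>) = 1 / (of_real \<sigma> - of_real \<sigma>\<^sub>0)" if "\<sigma>\<^sub>0 < \<sigma>" for \<sigma>
  proof -
    have "(\<integral>\<^sup>+x. ennreal (k x * exp (- (\<sigma> * ln x))) \<partial>restrict_space lborel {1..})
        = (\<integral>\<^sup>+x\<in>{1..}. ennreal (x powr (- (\<sigma> - \<sigma>\<^sub>0) - 1)) \<partial>lborel)"
      by (subst nn_integral_restrict_space)
         (auto intro!: nn_integral_cong simp: mellin_weight k_def algebra_simps simp flip: powr_add split: split_indicator)
    also have "\<dots> = ennreal (1 / (\<sigma> - \<sigma>\<^sub>0))"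
      using that by (intro nn_integral_powr_atLeast_1) simp
    finally have "(LINT x|restrict_space lborel {1..}. k x * exp (- (\<sigma> * ln x))) = 1 / (\<sigma> - \<sigma>\<^sub>0)"
      using that k_meas by (subst integral_eq_nn_integral) (auto simp: k_def)
    then show ?thesis
      by (simp add: mellin.transform_of_real)
  qed
  have "mellin.transform k s - 1 / (s - of_real \<sigma>\<^sub>0) = 0"
  proof (rule analytic_continuation[where S = H and U = "complex_of_real ` {\<sigma>\<^sub>0<..}" and \<xi> = "of_real (\<sigma>\<^sub>0 + 1)"
        and f = "\<lambda>s. mellin.transform k s - 1 / (s - of_real \<sigma>\<^sub>0)"])
    have "mellin.transform k holomorphic_on H"
      unfolding H_def using k_meas mellin_converges_powr
      by (intro mellin.transform_holomorphic) (auto simp: k_def)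
    moreover have "(\<lambda>s. 1 / (s - of_real \<sigma>\<^sub>0)) holomorphic_on H"
      by (auto simp: H_def intro!: holomorphic_intros)
    ultimately show "(\<lambda>s. mellin.transform k s - 1 / (s - of_real \<sigma>\<^sub>0)) holomorphic_on H"
      by (rule holomorphic_on_diff)
    show "open H" "connected H"
      by (auto simp: H_def open_halfspace_Re_gt intro: convex_connected convex_halfspace_Re_gt)
    show "complex_of_real (\<sigma>\<^sub>0 + 1) islimpt complex_of_real ` {\<sigma>\<^sub>0<..}"
      unfolding islimpt_approachable
    proof (intro allI impI)
      fix e :: real assume "0 < e"
      then show "\<exists>x'\<in>complex_of_real ` {\<sigma>\<^sub>0<..}. x' \<noteq> complex_of_real (\<sigma>\<^sub>0 + 1) \<and> dist x' (complex_of_real (\<sigma>\<^sub>0 + 1)) < e"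
        by (intro bexI[OF _ imageI[of "\<sigma>\<^sub>0 + 1 + e / 2"]] conjI)
           (simp_all only: dist_of_real of_real_eq_iff, simp_all add: dist_real_def)
    qed
  qed (use s real in \<open>auto simp: H_def\<close>)
  then show ?thesis
    by (simp add: k_def)
qed

section \<open>From small measure to small mass and a small transform\<close>

lemma set_integrable_bounded_mult_powr:
  fixes f :: "real \<Rightarrow> real"
  assumes [measurable]: "f \<in> borel_measurable lborel" and B: "\<And>x. x \<in> {T..T'} \<Longrightarrow> \<bar>f x\<bar> \<le> B"
    and T: "0 < T"
  shows "set_integrable lborel {T..T'} (\<lambda>x. f x * x powr p)"
proof (rule set_integrable_bound)
  show "set_integrable lborel {T..T'} (\<lambda>x. B * x powr p)"
    by (rule borel_integrable_atLeastAtMost') (use T in \<open>auto intro!: continuous_intros\<close>)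
  show "set_borel_measurable lborel {T..T'} (\<lambda>x. f x * x powr p)"
    unfolding set_borel_measurable_def by measurable
  show "AE x in lborel. x \<in> {T..T'} \<longrightarrow> norm (f x * x powr p) \<le> norm (B * x powr p)"
    using order_trans[OF B abs_ge_self] by (intro AE_I2) (auto simp: abs_mult intro!: mult_right_mono)
qed

text \<open>
  AM-GM with the weight \<open>\<theta> = \<delta> / (C h(T))\<close> plays the role of the Cauchy--Schwarz inequality.
\<close>

lemma dyadic_mass_tendsto_0:
  fixes \<Delta> h :: "real \<Rightarrow> real"
  assumes [measurable]: "\<Delta> \<in> borel_measurable lborel" "S \<in> sets lborel"
    and bdd: "\<And>X. \<exists>B. \<forall>x\<in>{1..X}. \<bar>\<Delta> x\<bar> \<le> B"
    and h_pos: "\<And>T. 1 \<le> T \<Longrightarrow> 0 < h T"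
    and mean_square: "(\<lambda>T. LINT x:({T..2*T} \<inter> S)|lborel. (\<Delta> x)\<^sup>2 / x powr (2 * \<sigma>\<^sub>0 + 1)) \<in> O[at_top](h)"
    and small: "(\<lambda>T. measure lborel (S \<inter> {T..2*T})) \<in> o[at_top](\<lambda>T. T / h T)"
  shows "((\<lambda>T. LINT x:({T..2*T} \<inter> S)|lborel. \<bar>\<Delta> x\<bar> * x powr (- \<sigma>\<^sub>0 - 1)) \<longlongrightarrow> 0) at_top"
proof (rule tendstoI)
  fix e :: real assume e: "0 < e"
  define \<delta> where "\<delta> = e / 2"
  have \<delta>: "0 < \<delta>" "\<delta> < e" using e by (simp_all add: \<delta>_def)
  define J where "J = (\<lambda>T. LINT x:({T..2*T} \<inter> S)|lborel. (\<Delta> x)\<^sup>2 / x powr (2 * \<sigma>\<^sub>0 + 1))"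
  define m where "m = (\<lambda>T. measure lborel (S \<inter> {T..2*T}))"
  obtain C where C: "0 < C" "\<forall>\<^sub>F T in at_top. norm (J T) \<le> C * norm (h T)"
    using mean_square unfolding J_def by (rule landau_o.bigE)
  have "0 < \<delta>\<^sup>2 / C"
    using \<delta> C by simp
  from landau_o.smallD[OF small this]
  have "\<forall>\<^sub>F T in at_top. norm (m T) \<le> \<delta>\<^sup>2 / C * norm (T / h T)"
    by (simp add: m_def)
  with C(2) eventually_ge_at_top[of 1]
  show "\<forall>\<^sub>F T in at_top. dist (LINT x:({T..2*T} \<inter> S)|lborel. \<bar>\<Delta> x\<bar> * x powr (- \<sigma>\<^sub>0 - 1)) 0 < e"
  proof eventually_elim
    case (elim T)
    have h: "0 < h T" using h_pos elim by simp
    define \<theta> where "\<theta> = \<delta> / (C * h T)"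
    have \<theta>: "0 < \<theta>" using \<delta> C h by (simp add: \<theta>_def)
    obtain B where B: "\<And>x. x \<in> {1..2*T} \<Longrightarrow> \<bar>\<Delta> x\<bar> \<le> B"
      using bdd by blast
    have B': "\<bar>\<bar>\<Delta> x\<bar>\<bar> \<le> B" "\<bar>(\<Delta> x)\<^sup>2\<bar> \<le> B\<^sup>2" if "x \<in> {T..2*T}" for x
      using B[of x] that elim power_mono[of "\<bar>\<Delta> x\<bar>" B 2] by auto
    have int1: "set_integrable lborel ({T..2*T} \<inter> S) (\<lambda>x. \<bar>\<Delta> x\<bar> * x powr (- \<sigma>\<^sub>0 - 1))"
      using B'(1) elim
      by (intro set_integrable_subset[OF set_integrable_bounded_mult_powr]) auto
    have "set_integrable lborel ({T..2*T} \<inter> S) (\<lambda>x. (\<Delta> x)\<^sup>2 * x powr (- (2 * \<sigma>\<^sub>0 + 1)))"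
      using B'(2) elim
      by (intro set_integrable_subset[OF set_integrable_bounded_mult_powr]) auto
    then have int2: "set_integrable lborel ({T..2*T} \<inter> S) (\<lambda>x. (\<Delta> x)\<^sup>2 / x powr (2 * \<sigma>\<^sub>0 + 1))"
      by (simp only: powr_minus divide_inverse)
    have "emeasure lborel ({T..2*T} \<inter> S) \<le> emeasure lborel {T..2*T}"
      by (intro emeasure_mono) auto
    also have "\<dots> < \<infinity>" using elim by simp
    finally have fin: "emeasure lborel ({T..2*T} \<inter> S) < \<infinity>" .
    then have int3: "set_integrable lborel ({T..2*T} \<inter> S) (\<lambda>x. 1 / (2 * \<theta> * T))"
      by (simp add: set_integrable_def)
    have pointwise: "\<bar>\<Delta> x\<bar> * x powr (- \<sigma>\<^sub>0 - 1) \<le> \<theta> / 2 * ((\<Delta> x)\<^sup>2 / x powr (2 * \<sigma>\<^sub>0 + 1)) + 1 / (2 * \<theta> * T)"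
      if "x \<in> {T..2*T} \<inter> S" for x
    proof -
      have x: "T \<le> x" "0 < x" using that elim by auto
      define y where "y = \<bar>\<Delta> x\<bar> * x powr - \<sigma>\<^sub>0"
      have "0 \<le> (\<theta> * y - 1)\<^sup>2" by simp
      then have "y \<le> \<theta> / 2 * y\<^sup>2 + 1 / (2 * \<theta>)"
        using \<theta> by (simp add: power2_eq_square field_simps)
      then have "y / x \<le> (\<theta> / 2 * y\<^sup>2 + 1 / (2 * \<theta>)) / x"
        using x by (intro divide_right_mono) auto
      also have "\<dots> = \<theta> / 2 * (y\<^sup>2 / x) + 1 / (2 * \<theta> * x)"
        by (simp add: add_divide_distrib)
      also have "1 / (2 * \<theta> * x) \<le> 1 / (2 * \<theta> * T)"
        using x \<theta> elim by (intro divide_left_mono mult_left_mono) auto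
      also have "y\<^sup>2 / x = (\<Delta> x)\<^sup>2 / x powr (2 * \<sigma>\<^sub>0 + 1)"
      proof -
        have "(x powr - \<sigma>\<^sub>0)\<^sup>2 = x powr - (2 * \<sigma>\<^sub>0)"
          by (simp add: power2_eq_square flip: powr_add)
        then show ?thesis
          using x by (simp add: y_def power_mult_distrib powr_add powr_minus divide_inverse)
      qed
      also have "y / x = \<bar>\<Delta> x\<bar> * x powr (- \<sigma>\<^sub>0 - 1)"
        using x by (simp add: y_def powr_diff)
      finally show ?thesis by simp
    qed
    have "(LINT x:({T..2*T} \<inter> S)|lborel. \<bar>\<Delta> x\<bar> * x powr (- \<sigma>\<^sub>0 - 1))
        \<le> (LINT x:({T..2*T} \<inter> S)|lborel. \<theta> / 2 * ((\<Delta> x)\<^sup>2 / x powr (2 * \<sigma>\<^sub>0 + 1)) + 1 / (2 * \<theta> * T))"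
      using int1 int2 int3 pointwise
      by (intro set_integral_mono set_integral_add set_integrable_mult_right) auto
    also have "\<dots> = (LINT x:({T..2*T} \<inter> S)|lborel. \<theta> / 2 * ((\<Delta> x)\<^sup>2 / x powr (2 * \<sigma>\<^sub>0 + 1)))
        + (LINT x:({T..2*T} \<inter> S)|lborel. 1 / (2 * \<theta> * T))"
      using int2 int3 by (intro set_integral_add set_integrable_mult_right) auto
    also have "\<dots> = \<theta> / 2 * J T + m T * (1 / (2 * \<theta> * T))"
      unfolding set_integral_mult_right J_def m_def
      using fin by (simp add: set_integral_const Int_commute)
    \<comment> \<open>The mean square bounds the first summand, the measure of the set the second;
      for the chosen \<open>\<theta>\<close> both bounds equal \<open>\<delta> / 2\<close>.\<close>
    also have "\<dots> \<le> \<theta> / 2 * (C * h T) + \<delta>\<^sup>2 / C * (T / h T) * (1 / (2 * \<theta> * T))"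
      using elim h \<theta> by (intro add_mono mult_left_mono mult_right_mono) auto
    also have "\<dots> = \<delta>"
      using elim h C \<delta> by (simp add: \<theta>_def power2_eq_square)
    finally have "(LINT x:({T..2*T} \<inter> S)|lborel. \<bar>\<Delta> x\<bar> * x powr (- \<sigma>\<^sub>0 - 1)) < e"
      using \<delta> by simp
    moreover have "0 \<le> (LINT x:({T..2*T} \<inter> S)|lborel. \<bar>\<Delta> x\<bar> * x powr (- \<sigma>\<^sub>0 - 1))"
      unfolding set_lebesgue_integral_def by (intro Bochner_Integration.integral_nonneg) auto
    ultimately show ?case by simp
  qed
qed

text \<open>The masses at \<open>T = 2 ^ k\<close> form a null sequence bounding the blocks of
  \<open>g\<close>. Summation over the blocks gives convergence, and the Abelian estimate gives
  growth \<open>o(1 / (\<sigma> - \<sigma>\<^sub>0))\<close>.\<close>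

lemma mellin_transform_small:
  fixes \<Delta> :: "real \<Rightarrow> real"
  assumes [measurable]: "\<Delta> \<in> borel_measurable lborel" "S \<in> sets lborel"
    and bdd: "\<And>X. \<exists>B. \<forall>x\<in>{1..X}. \<bar>\<Delta> x\<bar> \<le> B" and S: "S \<subseteq> {1..}"
    and mass: "((\<lambda>T. LINT x:({T..2*T} \<inter> S)|lborel. \<bar>\<Delta> x\<bar> * x powr (- \<sigma>\<^sub>0 - 1)) \<longlongrightarrow> 0) at_top"
  defines "g \<equiv> \<lambda>x. indicator S x * \<bar>\<Delta> x\<bar> / x"
  shows "\<sigma>\<^sub>0 < \<sigma> \<Longrightarrow> mellin.converges g \<sigma>"
    and "((\<lambda>\<sigma>. (\<sigma> - \<sigma>\<^sub>0) * (LINT x|restrict_space lborel {1..}. g x * exp (- (\<sigma> * ln x)))) \<longlongrightarrow> 0) (at_right \<sigma>\<^sub>0)"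
proof -
  define u where "u = (\<lambda>T. LINT x:({T..2*T} \<inter> S)|lborel. \<bar>\<Delta> x\<bar> * x powr (- \<sigma>\<^sub>0 - 1))"
  define v where "v = (\<lambda>k::nat. u (2 ^ k))"
  have [measurable]: "g \<in> borel_measurable lborel"
    unfolding g_def by measurable
  have g_nonneg: "0 \<le> g x" for x
    using S by (auto simp: g_def indicator_def)
  have v_lim: "v \<longlonglongrightarrow> 0"
    unfolding v_def using mass unfolding u_def[symmetric]
  proof (rule filterlim_compose)
    show "filterlim (\<lambda>k::nat. (2::real) ^ k) at_top sequentially"
      by (rule filterlim_at_top_mono[OF filterlim_real_sequentially])
         (simp add: less_imp_le[OF of_nat_less_two_power])
  qed
  have v_nonneg: "0 \<le> v k" for k
    unfolding v_def u_def set_lebesgue_integral_def by (intro Bochner_Integration.integral_nonneg) auto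
  have block: "(\<integral>\<^sup>+x\<in>{2 ^ k..2 * 2 ^ k}. ennreal (g x * x powr - \<sigma>\<^sub>0) \<partial>lborel) \<le> ennreal (v k)" for k
  proof -
    define I where "I = {2 ^ k..2 * (2 :: real) ^ k}"
    have I: "1 \<le> x" if "x \<in> I" for x
    proof -
      have "(1 :: real) \<le> 2 ^ k" by simp
      also have "2 ^ k \<le> x" using that by (simp add: I_def)
      finally show ?thesis .
    qed
    obtain B where B: "\<And>x. x \<in> {1..2 * 2 ^ k} \<Longrightarrow> \<bar>\<Delta> x\<bar> \<le> B"
      using bdd by blast
    have "set_integrable lborel (I \<inter> S) (\<lambda>x. \<bar>\<Delta> x\<bar> * x powr (- \<sigma>\<^sub>0 - 1))"
      using B I unfolding I_def
      by (intro set_integrable_subset[OF set_integrable_bounded_mult_powr[where B = B]]) auto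
    then have "(\<integral>\<^sup>+x. ennreal (indicator (I \<inter> S) x * (\<bar>\<Delta> x\<bar> * x powr (- \<sigma>\<^sub>0 - 1))) \<partial>lborel) = ennreal (v k)"
      unfolding v_def u_def I_def[symmetric] set_integrable_def set_lebesgue_integral_def
      by (subst nn_integral_eq_integral) auto
    moreover have "(\<integral>\<^sup>+x\<in>I. ennreal (g x * x powr - \<sigma>\<^sub>0) \<partial>lborel)
        = (\<integral>\<^sup>+x. ennreal (indicator (I \<inter> S) x * (\<bar>\<Delta> x\<bar> * x powr (- \<sigma>\<^sub>0 - 1))) \<partial>lborel)"
    proof (intro nn_integral_cong)
      fix x
      show "ennreal (g x * x powr - \<sigma>\<^sub>0) * indicator I x = ennreal (indicator (I \<inter> S) x * (\<bar>\<Delta> x\<bar> * x powr (- \<sigma>\<^sub>0 - 1)))"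
      proof (cases "x \<in> I \<inter> S")
        case True
        then show ?thesis
          using I[of x] by (simp add: g_def powr_diff)
      qed (auto simp: g_def indicator_def)
    qed
    ultimately show ?thesis
      by (simp add: I_def)
  qed
  define R where "R = (\<lambda>\<eta>. \<Sum>k. v k * (2 powr - \<eta>) ^ k)"
  have R: "0 \<le> R \<eta>" if "0 < \<eta>" for \<eta>
    unfolding R_def using abel_sum_small(2)[OF v_lim v_nonneg that] v_nonneg by (intro suminf_nonneg) auto
  have bound: "(\<integral>\<^sup>+x\<in>{1..}. ennreal (g x * x powr - \<tau>) \<partial>lborel) \<le> ennreal (R (\<tau> - \<sigma>\<^sub>0))" if "\<sigma>\<^sub>0 < \<tau>" for \<tau>
    unfolding R_def using dyadic_nn_integral_le[OF _ g_nonneg v_lim v_nonneg block that] by simp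
  show "mellin.converges g \<sigma>" if "\<sigma>\<^sub>0 < \<sigma>"
    using mellin_convergesI(1)[OF _ g_nonneg R bound] that by simp
  have upper: "(LINT x|restrict_space lborel {1..}. g x * exp (- (\<tau> * ln x))) \<le> R (\<tau> - \<sigma>\<^sub>0)" if "\<sigma>\<^sub>0 < \<tau>" for \<tau>
    using mellin_convergesI(2)[OF _ g_nonneg R bound] that by simp
  have lim: "((\<lambda>\<sigma>. (\<sigma> - \<sigma>\<^sub>0) * R (\<sigma> - \<sigma>\<^sub>0)) \<longlongrightarrow> 0) (at_right \<sigma>\<^sub>0)"
    using abel_sum_small(1)[OF v_lim v_nonneg] by (subst filterlim_at_right_to_0) (simp add: R_def)
  show "((\<lambda>\<sigma>. (\<sigma> - \<sigma>\<^sub>0) * (LINT x|restrict_space lborel {1..}. g x * exp (- (\<sigma> * ln x)))) \<longlongrightarrow> 0) (at_right \<sigma>\<^sub>0)"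
  proof (rule tendsto_sandwich[OF _ _ tendsto_const lim])
    show "\<forall>\<^sub>F \<sigma> in at_right \<sigma>\<^sub>0. 0 \<le> (\<sigma> - \<sigma>\<^sub>0) * (LINT x|restrict_space lborel {1..}. g x * exp (- (\<sigma> * ln x)))"
      using eventually_at_right_less[of \<sigma>\<^sub>0]
      by eventually_elim (intro mult_nonneg_nonneg Bochner_Integration.integral_nonneg, auto simp: g_nonneg)
    show "\<forall>\<^sub>F \<sigma> in at_right \<sigma>\<^sub>0. (\<sigma> - \<sigma>\<^sub>0) * (LINT x|restrict_space lborel {1..}. g x * exp (- (\<sigma> * ln x))) \<le> (\<sigma> - \<sigma>\<^sub>0) * R (\<sigma> - \<sigma>\<^sub>0)"
      using eventually_at_right_less[of \<sigma>\<^sub>0]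
      by eventually_elim (intro mult_left_mono upper, auto)
  qed
qed

section \<open>The one-sided omega result and its reflection\<close>

lemma one_sided_omega:
  fixes \<Delta> h :: "real \<Rightarrow> real" and A :: "complex \<Rightarrow> complex"
  assumes bdd: "\<And>X. \<exists>B. \<forall>x\<in>{1..X}. \<bar>\<Delta> x\<bar> \<le> B"
    and mellin: "mellin_continuation \<Delta> A U"
    and U_near: "\<forall>\<^sub>F \<sigma> in at_right \<sigma>\<^sub>0. Complex \<sigma> t\<^sub>0 \<in> U"
    and U_right: "connected (U \<inter> {s. \<sigma>\<^sub>0 < Re s})"
    and V: "open V" "V \<subseteq> U" "\<And>\<sigma>. \<sigma>\<^sub>0 < \<sigma> \<Longrightarrow> complex_of_real \<sigma> \<in> V" "A analytic_on V"
    and t\<^sub>0: "t\<^sub>0 \<noteq> 0"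
    and lambda: "Limsup (at_right \<sigma>\<^sub>0) (\<lambda>\<sigma>. ereal ((\<sigma> - \<sigma>\<^sub>0) * cmod (A (Complex \<sigma> t\<^sub>0)))) = ereal lam"
    and li: "Liminf (at_right \<sigma>\<^sub>0) (\<lambda>\<sigma>. ereal ((\<sigma> - \<sigma>\<^sub>0) * Re (A (complex_of_real \<sigma>)))) = ereal l"
    and \<epsilon>: "0 < \<epsilon>" "\<epsilon> < lam + l"
    and S: "S = {x\<in>{1..}. (l + lam - \<epsilon>) * x powr \<sigma>\<^sub>0 < \<Delta> x}"
    and h_pos: "\<And>T. 1 \<le> T \<Longrightarrow> 0 < h T"
    and mean_square: "(\<lambda>T. LINT x:({T..2*T} \<inter> S)|lborel. (\<Delta> x)\<^sup>2 / x powr (2 * \<sigma>\<^sub>0 + 1)) \<in> O[at_top](h)"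
  shows "(\<lambda>T. measure lborel (S \<inter> {T..2*T})) \<notin> o[at_top](\<lambda>T. T / h T)"
proof
  assume small: "(\<lambda>T. measure lborel (S \<inter> {T..2*T})) \<in> o[at_top](\<lambda>T. T / h T)"
  define c\<^sub>0 where "c\<^sub>0 = l + lam - \<epsilon>"
  have c\<^sub>0: "0 < c\<^sub>0" using \<epsilon> by (simp add: c\<^sub>0_def)
  obtain c where U: "open U" and A: "A nicely_meromorphic_on U"
    and c: "\<And>s. c < Re s \<Longrightarrow> s \<in> U"
      "\<And>s. c < Re s \<Longrightarrow> set_integrable lborel {1..} (\<lambda>x. of_real (\<Delta> x) * of_real x powr (- s - 1))"
      "\<And>s. c < Re s \<Longrightarrow> A s = (LINT x:{1..}|lborel. of_real (\<Delta> x) * of_real x powr (- s - 1))"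
    using mellin by (auto simp: mellin_continuation_def)
  \<comment> \<open>The Mellin integrand carries information on \<open>[1, \<infinity>)\<close>
    only, so \<open>\<Delta>\<close> is truncated. Measurability of \<open>E\<close> follows from
    integrability at the real point \<open>c + 1\<close>, after removal of the power
    \<open>x powr (- (c + 2))\<close>.\<close>
  define E where "E = (\<lambda>x. indicator {1..} x * \<Delta> x)"
  have E_eq: "E x = \<Delta> x" if "1 \<le> x" for x
    using that by (simp add: E_def)
  have E_meas [measurable]: "E \<in> borel_measurable lborel"
  proof -
    define f where "f = (\<lambda>x. indicator {1..} x *\<^sub>R (complex_of_real (\<Delta> x) * of_real x powr (- of_real (c + 1) - 1)))"
    have [measurable]: "f \<in> borel_measurable lborel"
      using c(2)[of "of_real (c + 1)"] unfolding set_integrable_def f_def by (simp add: borel_measurable_integrable)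
    have "E x = Re (f x) * x powr (c + 2)" for x
    proof (cases "1 \<le> x")
      case True
      have "complex_of_real x powr (- of_real (c + 1) - 1) = complex_of_real (x powr (- (c + 2)))"
      proof -
        have "- complex_of_real (c + 1) - 1 = of_real (- (c + 2))" by simp
        then show ?thesis using True powr_of_real[of x "- (c + 2)"] by (simp only:)
      qed
      then show ?thesis
        using True by (simp add: f_def E_eq flip: powr_add)
    qed (simp add: f_def E_def)
    then have "E = (\<lambda>x. Re (f x) * x powr (c + 2))" by blast
    then show ?thesis by simp
  qed
  have S_eq: "S = {x \<in> space lborel. 1 \<le> x \<and> c\<^sub>0 * x powr \<sigma>\<^sub>0 < E x}"
    using E_eq by (auto simp: S c\<^sub>0_def)
  have S_meas [measurable]: "S \<in> sets lborel"
    unfolding S_eq by measurable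
  have S_ge: "S \<subseteq> {1..}"
    by (auto simp: S)
  have E_bdd: "\<exists>B. \<forall>x\<in>{1..X}. \<bar>E x\<bar> \<le> B" for X
    using bdd[of X] E_eq by auto
  have "(LINT x:({T..2*T} \<inter> S)|lborel. (\<Delta> x)\<^sup>2 / x powr (2 * \<sigma>\<^sub>0 + 1))
      = (LINT x:({T..2*T} \<inter> S)|lborel. (E x)\<^sup>2 / x powr (2 * \<sigma>\<^sub>0 + 1))" for T
    using S_ge E_eq by (intro set_lebesgue_integral_cong) auto
  then have "(\<lambda>T. LINT x:({T..2*T} \<inter> S)|lborel. (E x)\<^sup>2 / x powr (2 * \<sigma>\<^sub>0 + 1)) \<in> O[at_top](h)"
    using mean_square by simp
  from dyadic_mass_tendsto_0[OF E_meas S_meas E_bdd h_pos this small]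
  have mass: "((\<lambda>T. LINT x:({T..2*T} \<inter> S)|lborel. \<bar>E x\<bar> * x powr (- \<sigma>\<^sub>0 - 1)) \<longlongrightarrow> 0) at_top" .
  define g where "g = (\<lambda>x. indicator S x * \<bar>E x\<bar> / x)"
  define \<phi> where "\<phi> = (\<lambda>x. E x / x)"
  define G where "G = (\<lambda>\<sigma>. LINT x|restrict_space lborel {1..}. g x * exp (- (\<sigma> * ln x)))"
  have meas: "\<phi> \<in> borel_measurable (restrict_space lborel {1..})"
    "g \<in> borel_measurable (restrict_space lborel {1..})"
    "(\<lambda>x. x powr (\<sigma>\<^sub>0 - 1)) \<in> borel_measurable (restrict_space lborel {1..})"
    unfolding \<phi>_def g_def by (rule measurable_restrict_space1, measurable)+
  have conv_g: "mellin.converges g \<sigma>" if "\<sigma>\<^sub>0 < \<sigma>" for \<sigma>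
    unfolding g_def using mellin_transform_small(1)[OF E_meas S_meas E_bdd S_ge mass that] .
  have G_lim: "((\<lambda>\<sigma>. (\<sigma> - \<sigma>\<^sub>0) * G \<sigma>) \<longlongrightarrow> 0) (at_right \<sigma>\<^sub>0)"
    unfolding G_def g_def using mellin_transform_small(2)[OF E_meas S_meas E_bdd S_ge mass] .
  have integrand: "indicator {1..} x *\<^sub>R (of_real (\<phi> x) * exp (- (s * of_real (ln x))))
      = indicator {1..} x *\<^sub>R (of_real (\<Delta> x) * of_real x powr (- s - 1))" for s :: complex and x
    using mellin_integrand[of x \<Delta> s] by (auto simp: \<phi>_def E_eq split: split_indicator)
  have A_eq: "s \<in> U \<and> A s = mellin.transform \<phi> s" if "c + 1 < Re s" for s
    using c[of s] that
    by (simp add: mellin.transform_def integral_restrict_space integrand set_lebesgue_integral_def)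
  have conv_\<phi>: "mellin.converges \<phi> (c + 1)"
  proof -
    have "complex_integrable (restrict_space lborel {1..})
        (\<lambda>x. of_real (\<phi> x) * exp (- (of_real (c + 1) * of_real (ln x))))"
      using c(2)[of "of_real (c + 1)"] unfolding set_integrable_def
      by (subst integrable_restrict_space) (simp_all only: integrand, simp_all)
    then have "complex_integrable (restrict_space lborel {1..})
        (\<lambda>x. complex_of_real (\<phi> x * exp (- ((c + 1) * ln x))))"
      by (simp flip: exp_of_real)
    then show ?thesis
      unfolding mellin.converges_def complex_of_real_integrable_eq .
  qed
  \<comment> \<open>On \<open>S\<close> the summand \<open>g\<close> dominates alone; off
    \<open>S\<close> the inequality defining \<open>S\<close> fails, which is the other
    bound.\<close>
  have majorant: "\<phi> x \<le> c\<^sub>0 * x powr (\<sigma>\<^sub>0 - 1) + g x" if "x \<in> space (restrict_space lborel {1..})" for x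
  proof (cases "x \<in> S")
    case True
    then show ?thesis
      using c\<^sub>0 S_ge by (auto simp: g_def \<phi>_def intro!: add_increasing divide_right_mono)
  next
    case False
    have x: "1 \<le> x" using that by (simp add: space_restrict_space)
    then have "E x \<le> c\<^sub>0 * x powr \<sigma>\<^sub>0"
      using False by (auto simp: S_eq)
    then have "E x / x \<le> c\<^sub>0 * x powr \<sigma>\<^sub>0 / x"
      using x by (intro divide_right_mono) auto
    then show ?thesis
      using False x by (simp add: g_def \<phi>_def powr_diff)
  qed
  have bound: "norm (A (Complex \<sigma> t\<^sub>0)) \<le> c\<^sub>0 / norm (Complex (\<sigma> - \<sigma>\<^sub>0) t\<^sub>0) + c\<^sub>0 / (\<sigma> - \<sigma>\<^sub>0) + 2 * G \<sigma> - Re (A (of_real \<sigma>))"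
    if "\<sigma>\<^sub>0 < \<sigma>" "Complex \<sigma> t\<^sub>0 \<in> U" for \<sigma>
    unfolding G_def
  proof (rule mellin.norm_continuation_le[OF meas])
    show "0 \<le> g x" if "x \<in> space (restrict_space lborel {1..})" for x
      using that by (simp add: g_def space_restrict_space)
  qed (fact majorant less_imp_le[OF c\<^sub>0] conv_g mellin_converges_powr mellin_transform_powr
      A U U_right V conv_\<phi> A_eq that)+
  \<comment> \<open>The losses are \<open>\<epsilon> / 8\<close> from
    \<open>c\<^sub>0 / (s - \<sigma>\<^sub>0)\<close> at height \<open>t\<^sub>0\<close>, twice
    \<open>\<epsilon> / 16\<close> from \<open>G\<close>, and \<open>\<epsilon> / 4\<close> from the
    liminf. Their sum \<open>\<epsilon> / 2\<close> is half of the gap in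
    \<open>c\<^sub>0 - l = lam - \<epsilon>\<close>.\<close>
  have "\<forall>\<^sub>F \<sigma> in at_right \<sigma>\<^sub>0. (\<sigma> - \<sigma>\<^sub>0) * (c\<^sub>0 / \<bar>t\<^sub>0\<bar>) < \<epsilon> / 8"
  proof (rule order_tendstoD)
    show "((\<lambda>\<sigma>. (\<sigma> - \<sigma>\<^sub>0) * (c\<^sub>0 / \<bar>t\<^sub>0\<bar>)) \<longlongrightarrow> (\<sigma>\<^sub>0 - \<sigma>\<^sub>0) * (c\<^sub>0 / \<bar>t\<^sub>0\<bar>)) (at_right \<sigma>\<^sub>0)"
      by (intro tendsto_intros)
  qed (use \<epsilon> in simp)
  moreover have "\<forall>\<^sub>F \<sigma> in at_right \<sigma>\<^sub>0. (\<sigma> - \<sigma>\<^sub>0) * G \<sigma> < \<epsilon> / 16"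
    using \<epsilon> by (intro order_tendstoD(2)[OF G_lim]) simp
  moreover have "\<forall>\<^sub>F \<sigma> in at_right \<sigma>\<^sub>0. ereal (l - \<epsilon> / 4) < ereal ((\<sigma> - \<sigma>\<^sub>0) * Re (A (complex_of_real \<sigma>)))"
    using \<epsilon> by (intro less_LiminfD) (simp add: li)
  ultimately have "\<forall>\<^sub>F \<sigma> in at_right \<sigma>\<^sub>0. ereal ((\<sigma> - \<sigma>\<^sub>0) * cmod (A (Complex \<sigma> t\<^sub>0))) \<le> ereal (lam - \<epsilon> / 2)"
    using U_near eventually_at_right_less[of \<sigma>\<^sub>0]
  proof eventually_elim
    case (elim \<sigma>)
    define d where "d = \<sigma> - \<sigma>\<^sub>0"
    have d: "0 < d" using elim by (simp add: d_def)
    have "\<bar>t\<^sub>0\<bar> \<le> norm (Complex d t\<^sub>0)"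
      using abs_Im_le_cmod[of "Complex d t\<^sub>0"] by simp
    then have "c\<^sub>0 / norm (Complex d t\<^sub>0) \<le> c\<^sub>0 / \<bar>t\<^sub>0\<bar>"
      using c\<^sub>0 t\<^sub>0 by (intro divide_left_mono mult_pos_pos) auto
    with bound[of \<sigma>] elim
    have "norm (A (Complex \<sigma> t\<^sub>0)) \<le> c\<^sub>0 / \<bar>t\<^sub>0\<bar> + c\<^sub>0 / d + 2 * G \<sigma> - Re (A (of_real \<sigma>))"
      by (simp add: d_def)
    then have "d * norm (A (Complex \<sigma> t\<^sub>0)) \<le> d * (c\<^sub>0 / \<bar>t\<^sub>0\<bar> + c\<^sub>0 / d + 2 * G \<sigma> - Re (A (of_real \<sigma>)))"
      using d by (intro mult_left_mono) auto
    also have "\<dots> = d * (c\<^sub>0 / \<bar>t\<^sub>0\<bar>) + c\<^sub>0 + 2 * (d * G \<sigma>) - d * Re (A (of_real \<sigma>))"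
      using d by (simp add: algebra_simps)
    also have "\<dots> \<le> \<epsilon> / 8 + c\<^sub>0 + 2 * (\<epsilon> / 16) - (l - \<epsilon> / 4)"
      using elim(1,2,3) unfolding d_def less_ereal.simps by linarith
    also have "\<dots> = lam - \<epsilon> / 2"
      by (simp add: c\<^sub>0_def)
    finally show ?case by (simp add: d_def)
  qed
  then have "ereal lam \<le> ereal (lam - \<epsilon> / 2)"
    unfolding lambda[symmetric] by (rule Limsup_bounded)
  then show False
    using \<epsilon> by simp
qed

lemma mellin_continuation_uminus:
  assumes "mellin_continuation \<Delta> A U"
  shows "mellin_continuation (\<lambda>x. - \<Delta> x) (\<lambda>s. - A s) U"
  using assms unfolding mellin_continuation_def
  by (auto simp: set_integrable_def set_lebesgue_integral_def intro!: nicely_meromorphic_on_uminus)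

theorem theorem3p4:
  fixes a :: "nat \<Rightarrow> real" and D A :: "complex \<Rightarrow> complex"
    and T\<^sub>0 \<sigma>\<^sub>1 \<sigma>\<^sub>2 \<sigma>\<^sub>0 t\<^sub>0 lam l\<^sub>s l\<^sub>i \<epsilon> :: real
    and \<Delta> h\<^sub>1 h\<^sub>2 :: "real \<Rightarrow> real" and U :: "complex set" and A\<^sub>1 A\<^sub>2 :: "real set"
  assumes setting: "dirichlet_setting a D T\<^sub>0 \<sigma>\<^sub>1 \<sigma>\<^sub>2"
    and Delta: "\<Delta> = error_term a D T\<^sub>0 \<sigma>\<^sub>1"
    and mellin: "mellin_continuation \<Delta> A U"
    and U_half_line: "{complex_of_real \<sigma> |\<sigma>. \<sigma> > \<sigma>\<^sub>0} \<subseteq> U"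
    and U_near_t0: "\<forall>\<^sub>F \<sigma> in at_right \<sigma>\<^sub>0. Complex \<sigma> t\<^sub>0 \<in> U"
    and U_right: "connected (U \<inter> {s. Re s > \<sigma>\<^sub>0})"
    and t0: "t\<^sub>0 \<noteq> 0"
    and lambda: "Limsup (at_right \<sigma>\<^sub>0) (\<lambda>\<sigma>. ereal ((\<sigma> - \<sigma>\<^sub>0) * cmod (A (Complex \<sigma> t\<^sub>0)))) = ereal lam"
    and lambda_pos: "lam > 0"
    and ls: "Limsup (at_right \<sigma>\<^sub>0) (\<lambda>\<sigma>. ereal ((\<sigma> - \<sigma>\<^sub>0) * Re (A (complex_of_real \<sigma>)))) = ereal l\<^sub>s"
    and li: "Liminf (at_right \<sigma>\<^sub>0) (\<lambda>\<sigma>. ereal ((\<sigma> - \<sigma>\<^sub>0) * Re (A (complex_of_real \<sigma>)))) = ereal l\<^sub>i"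
    and li_lambda: "l\<^sub>i + lam > 0" and ls_lambda: "l\<^sub>s - lam < 0"
    and analytic: "\<exists>V. open V \<and> connected V \<and> V \<subseteq> U \<and>
                     {complex_of_real \<sigma> |\<sigma>. \<sigma> > \<sigma>\<^sub>0} \<subseteq> V \<and> A analytic_on V"
    and eps: "0 < \<epsilon>" "\<epsilon> < min (lam + l\<^sub>i) (lam - l\<^sub>s)"
    and A1: "A\<^sub>1 = {x\<in>{1..}. \<Delta> x > (l\<^sub>i + lam - \<epsilon>) * x powr \<sigma>\<^sub>0}"
    and A2: "A\<^sub>2 = {x\<in>{1..}. \<Delta> x < (l\<^sub>s - lam + \<epsilon>) * x powr \<sigma>\<^sub>0}"
    and h1_pos: "\<And>T. T \<ge> 1 \<Longrightarrow> h\<^sub>1 T > 0" and h2_pos: "\<And>T. T \<ge> 1 \<Longrightarrow> h\<^sub>2 T > 0"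
    and h1: "(\<lambda>T. LINT x:({T..2*T} \<inter> A\<^sub>1)|lborel. (\<Delta> x)\<^sup>2 / x powr (2 * \<sigma>\<^sub>0 + 1)) \<in> O[at_top](h\<^sub>1)"
    and h2: "(\<lambda>T. LINT x:({T..2*T} \<inter> A\<^sub>2)|lborel. (\<Delta> x)\<^sup>2 / x powr (2 * \<sigma>\<^sub>0 + 1)) \<in> O[at_top](h\<^sub>2)"
  shows "(\<lambda>T. measure lborel (A\<^sub>1 \<inter> {T..2*T})) \<notin> o[at_top](\<lambda>T. T / h\<^sub>1 T) \<and>
         (\<lambda>T. measure lborel (A\<^sub>2 \<inter> {T..2*T})) \<notin> o[at_top](\<lambda>T. T / h\<^sub>2 T)"
proof -
  obtain V where V: "open V" "V \<subseteq> U" "A analytic_on V" "{complex_of_real \<sigma> |\<sigma>. \<sigma> > \<sigma>\<^sub>0} \<subseteq> V"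
    using analytic by blast
  have V_real: "complex_of_real \<sigma> \<in> V" if "\<sigma>\<^sub>0 < \<sigma>" for \<sigma>
    using V(4) that by blast
  have bdd: "\<exists>B. \<forall>x\<in>{1..X}. \<bar>\<Delta> x\<bar> \<le> B" for X
    unfolding Delta by (rule error_term_bounded[OF setting])
  have "(\<lambda>T. measure lborel (A\<^sub>1 \<inter> {T..2*T})) \<notin> o[at_top](\<lambda>T. T / h\<^sub>1 T)"
    by (rule one_sided_omega[OF bdd mellin U_near_t0 U_right V(1,2) V_real V(3) t0 lambda li eps(1) _ A1 h1_pos h1])
       (use eps(2) in simp_all)
  moreover have "(\<lambda>T. measure lborel (A\<^sub>2 \<inter> {T..2*T})) \<notin> o[at_top](\<lambda>T. T / h\<^sub>2 T)"
  \<comment> \<open>Reflection turns \<open>A\<^sub>2\<close> into the upper set of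
    \<open>- \<Delta>\<close>. The liminf becomes \<open>- l\<^sub>s\<close>, the value
    \<open>lam\<close> is unchanged, and the condition on \<open>\<epsilon>\<close> reads
    \<open>\<epsilon> < lam - l\<^sub>s\<close>.\<close>
  proof (rule one_sided_omega[OF _ mellin_continuation_uminus[OF mellin] U_near_t0 U_right V(1,2) V_real _ t0 _ _ eps(1) _ _ h2_pos])
    show "\<exists>B. \<forall>x\<in>{1..X}. \<bar>- \<Delta> x\<bar> \<le> B" for X
      using bdd[of X] by simp
    show "(\<lambda>s. - A s) analytic_on V"
      using V(3) by (rule analytic_on_neg)
    show "Limsup (at_right \<sigma>\<^sub>0) (\<lambda>\<sigma>. ereal ((\<sigma> - \<sigma>\<^sub>0) * cmod (- A (Complex \<sigma> t\<^sub>0)))) = ereal lam"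
      using lambda by simp
    show "Liminf (at_right \<sigma>\<^sub>0) (\<lambda>\<sigma>. ereal ((\<sigma> - \<sigma>\<^sub>0) * Re (- A (complex_of_real \<sigma>)))) = ereal (- l\<^sub>s)"
      using ereal_Liminf_uminus[of "at_right \<sigma>\<^sub>0" "\<lambda>\<sigma>. ereal ((\<sigma> - \<sigma>\<^sub>0) * Re (A (complex_of_real \<sigma>)))"] ls
      by simp
    show "A\<^sub>2 = {x\<in>{1..}. (- l\<^sub>s + lam - \<epsilon>) * x powr \<sigma>\<^sub>0 < - \<Delta> x}"
      unfolding A2 by (auto simp: algebra_simps)
    show "(\<lambda>T. LINT x:({T..2*T} \<inter> A\<^sub>2)|lborel. (- \<Delta> x)\<^sup>2 / x powr (2 * \<sigma>\<^sub>0 + 1)) \<in> O[at_top](h\<^sub>2)"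
      using h2 by simp
  qed (use eps(2) in simp_all)
  ultimately show ?thesis ..
qed

end
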